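(* Let $\alpha\in K^{(2)}$ be a quadratic power series and let $m$ be an integer such that $q^{-m}\in \mathrm{Sp}(\alpha)$. Then there exists a quadratic power series $f\in K^{(2)}\setminus\Theta_\alpha$ such that $c_\alpha(f)=q^{-m}$.
   Context: Let $q$ be a positive power of a prime, $\mathbb F_q$ the field with $q$ elements, $R=\mathbb F_q[Y]$, $K=\mathbb F_q(Y)$, and $\widehat K=\mathbb F_q((Y^{-1}))$, the completion of $K$ for the absolute value $|P/Q|=q^{\deg P-\deg Q}$ ($P,Q\in R\setminus\{0\}$), extended to $\widehat K$. Let $K^{(2)}=\{f\in\widehat K: [K(f):K]=2\}$ (quadratic power series). For $\alpha\in K^{(2)}$, $\alpha^\sigma$ denotes its Galois conjugate over $K$ (well defined and distinct from $\alpha$, also in characteristic 2). The group $\mathrm{PGL}_2(R)$ acts on $\widehat K\cup\{\infty\}$ by homographies; set $\Theta_\alpha=\mathrm{PGL}_2(R)\cdot\{\alpha,\alpha^\sigma\}$. For $f\in\widehat K\setminus(K\cup\Theta_\alpha)$ define $c_\alpha(f)=\liminf_{\beta\in\Theta_\alpha,\ |\beta-\beta^\sigma|\to0}\frac{|f-\beta|}{|\beta-\beta^\sigma|}$, and the quadratic Lagrange spectrum $\mathrm{Sp}(\alpha)=\{c_\alpha(f): f\in\widehat K\setminus(K\cup\Theta_\alpha)\}$. *)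

theory Defs
  imports "HOL-Analysis.Analysis" "HOL-Computational_Algebra.Computational_Algebra"
    "HOL-Library.Liminf_Limsup"
begin

text \<open>The completion of K = F_q(Y) at infinity is F_q((Y^-1)), modelled as formal Laurent
  series in the variable X = Y^-1; thus Y itself is fls_X_inv.  The finite field F_q is
  any type of class finite and field, with q = CARD('a).\<close>

definition polyY :: "'a::field poly \<Rightarrow> 'a fls" where
  "polyY P = poly (map_poly fls_const P) fls_X_inv"

definition inR :: "'a::field fls \<Rightarrow> bool" where
  "inR f \<longleftrightarrow> (\<exists>P. f = polyY P)"

definition inK :: "'a::field fls \<Rightarrow> bool" where
  "inK f \<longleftrightarrow> (\<exists>P Q. Q \<noteq> 0 \<and> f = polyY P / polyY Q)"

text \<open>Absolute value |f| = q^(deg in Y) = q^(- order in Y^-1), |0| = 0.\<close>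
definition absv :: "'a::{finite,field} fls \<Rightarrow> real" where
  "absv f = (if f = 0 then 0 else real CARD('a) powr (- real_of_int (fls_subdegree f)))"

text \<open>Quadratic power series: [K(f):K] = 2, i.e. f is not in K but is a root of a
  nonzero polynomial of degree 2 over K (equivalently, clearing denominators, over R).\<close>
definition quadratic :: "'a::field fls \<Rightarrow> bool" where
  "quadratic f \<longleftrightarrow> \<not> inK f \<and>
     (\<exists>A B C. A \<noteq> 0 \<and> polyY A * f\<^sup>2 + polyY B * f + polyY C = 0)"

text \<open>Galois conjugate: if A x^2 + B x + C (A \<noteq> 0, coefficients in R) vanishes at a
  quadratic f, it is a multiple of the minimal polynomial, and the other root is -B/A - f.\<close>
definition conj :: "'a::field fls \<Rightarrow> 'a fls" where
  "conj f = (SOME g. \<exists>A B C. A \<noteq> 0 \<and> polyY A * f\<^sup>2 + polyY B * f + polyY C = 0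
                          \<and> g = - polyY B / polyY A - f)"

text \<open>Theta_alpha = PGL_2(R) . {alpha, alpha^sigma}; matrices over R with unit determinant
  (a nonzero constant polynomial) acting by homographies.\<close>
definition Theta :: "'a::field fls \<Rightarrow> 'a fls set" where
  "Theta \<alpha> = {(polyY a * \<gamma> + polyY b) / (polyY c * \<gamma> + polyY d) | a b c d \<gamma>.
      a * d - b * c \<noteq> 0 \<and> degree (a * d - b * c) = 0 \<and> \<gamma> \<in> {\<alpha>, conj \<alpha>}}"

definition c_alpha :: "'a::{finite,field} fls \<Rightarrow> 'a fls \<Rightarrow> ereal" where
  "c_alpha \<alpha> f = Liminf (inf (filtercomap (\<lambda>\<beta>. absv (\<beta> - conj \<beta>)) (nhds 0)) (principal (Theta \<alpha>)))
      (\<lambda>\<beta>. ereal (absv (f - \<beta>) / absv (\<beta> - conj \<beta>)))"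

definition Sp :: "'a::{finite,field} fls \<Rightarrow> ereal set" where
  "Sp \<alpha> = {c_alpha \<alpha> f | f. \<not> inK f \<and> f \<notin> Theta \<alpha>}"

end

(*
  A homography in SL_2 of the polynomial ring that nearly stabilises f, in the sense that it carries
  balls around f of radius about r to balls around f of radius about r' < r, has an attracting fixed
  point z close to f, and z is a quadratic power series.  If c_alpha(f) = q^(-m), then
  |f - beta| = q^(-m) |beta - beta^sigma| at infinitely many scales r = |beta - beta^sigma|.  The
  discriminant is constant on Theta_alpha, so the ball of center f at each of these scales, viewed as
  a norm on K^2, has no short integral vector; by reduction theory these balls lie in a compact set
  modulo SL_2.  By pigeonhole two of them are nearly equivalent, and this gives the homography.
  Below the scale r the approximation behaviour of z repeats periodically that of f between r' and r,
  whence c_alpha(z) = q^(-m).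
*)
theory Submission
  imports Defs
begin

unbundle fps_syntax

section \<open>The absolute value and the embedded polynomials\<close>

text \<open>Nonzero absolute values are powers of q, so a lower limit equal to q^(-m) is attained:
  c_alpha(f) = q^(-m) splits into an eventual lower bound and infinitely many equalities, and only
  exact relations are carried from f to z. Equalities move down the scales: the homography divides
  |z - beta| and |beta - beta^sigma| by the same factor while both conjugates are near z. The lower
  bound is tested by moving up the scales with the inverse homography, and there lies the obstacle:
  beta^sigma may be far from z, so |beta - beta^sigma| need not grow by the same factor as |z -
  beta|. The remedy is to bound |z - beta| below by kappa R for every small R <= |beta -
  beta^sigma|, with R a free parameter. Applied to beta = z, this version also excludes z from
  Theta_alpha.\<close>

lemma card_field_gt_1: "1 < real CARD('a::{finite,field})"
proof -
  have "card {0, 1 :: 'a} \<le> CARD('a)"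
    by (intro card_mono) auto
  then show ?thesis
    by simp
qed

lemma absv_0 [simp]: "absv 0 = 0"
  by (simp add: absv_def)

lemma absv_nonzero:
  fixes x :: "'a::{finite,field} fls"
  assumes "x \<noteq> 0"
  shows "absv x = real CARD('a) powi (- fls_subdegree x)"
  using assms card_field_gt_1[where 'a='a] powr_real_of_int'[of "real CARD('a)" "- fls_subdegree x"]
  by (simp add: absv_def)

lemma absv_eq_0_iff [simp]: "absv x = 0 \<longleftrightarrow> x = 0"
  using card_field_gt_1[where 'a='a] by (auto simp: absv_def)

lemma absv_nonneg [simp]: "0 \<le> absv x"
  by (simp add: absv_def)

lemma absv_pos_iff [simp]: "0 < absv x \<longleftrightarrow> x \<noteq> 0"
  using absv_nonneg[of x] absv_eq_0_iff[of x] by linarith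

lemma absv_mult: "absv (x * y) = absv x * absv y"
proof (cases "x = 0 \<or> y = 0")
  case False
  then show ?thesis
    using card_field_gt_1[where 'a='a]
    by (simp add: absv_def powr_add flip: powr_add)
qed auto

lemma absv_1 [simp]: "absv 1 = 1"
  by (simp add: absv_nonzero)

lemma absv_minus [simp]: "absv (- x) = absv x"
  by (simp add: absv_def)

lemma absv_minus_commute: "absv (x - y) = absv (y - x)"
  by (metis absv_minus minus_diff_eq)

lemma absv_power: "absv (x ^ n) = absv x ^ n"
  by (induction n) (auto simp: absv_mult)

lemma absv_inverse: "absv (inverse x) = inverse (absv x)"
proof (cases "x = 0")
  case False
  then have "absv x * absv (inverse x) = 1"
    by (simp flip: absv_mult)
  then show ?thesis
    by (simp add: inverse_unique)
qed auto

lemma absv_divide: "absv (x / y) = absv x / absv y"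
  by (simp add: divide_inverse absv_mult absv_inverse)

lemma powi_less_iff:
  fixes b :: real
  assumes "1 < b"
  shows "b powi k < b powi l \<longleftrightarrow> k < l"
  using power_int_strict_increasing[of k l b] power_int_increasing[of l k b] assms
  by (cases "k < l") auto

lemma powi_le_iff:
  fixes b :: real
  assumes "1 < b"
  shows "b powi k \<le> b powi l \<longleftrightarrow> k \<le> l"
  using powi_less_iff[OF assms, of l k] by auto

text \<open>Balls are given by the vanishing of initial coefficients; the strong triangle
  inequality, the approximation by polynomials and the total boundedness of balls are all read off
  from this.\<close>

lemma absv_le_iff:
  fixes x :: "'a::{finite,field} fls"
  shows "absv x \<le> real CARD('a) powi (- n) \<longleftrightarrow> (\<forall>i<n. x $$ i = 0)"
proof (cases "x = 0")
  case False
  have "absv x \<le> real CARD('a) powi (- n) \<longleftrightarrow> n \<le> fls_subdegree x"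
    unfolding absv_nonzero[OF False] powi_le_iff[OF card_field_gt_1] by auto
  also have "\<dots> \<longleftrightarrow> (\<forall>i<n. x $$ i = 0)"
    using False fls_subdegree_geI[of x n] by (metis fls_eq0_below_subdegree less_le_trans)
  finally show ?thesis .
qed auto

lemma absv_fls_X_intpow:
  "absv (fls_X_intpow n :: 'a::{finite,field} fls) = real CARD('a) powi (- n)"
  by (simp add: absv_nonzero)

lemma absv_add_le: "absv (x + y) \<le> max (absv x) (absv y)"
proof -
  have *: "absv (x + y) \<le> absv y" if "absv x \<le> absv y" for x y :: "'a fls"
  proof (cases "y = 0")
    case True
    with that have "x = 0"
      by (simp add: order_antisym_conv)
    with True show ?thesis
      by simp
  next
    case False
    with that show ?thesis
      by (auto simp: absv_nonzero absv_le_iff)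
  qed
  show ?thesis
    using *[of x y] *[of y x] by (simp add: add.commute max_def)
qed

lemma absv_add_le': "absv x \<le> r \<Longrightarrow> absv y \<le> r \<Longrightarrow> absv (x + y) \<le> r"
  using absv_add_le[of x y] by auto

lemma absv_diff_le': "absv x \<le> r \<Longrightarrow> absv y \<le> r \<Longrightarrow> absv (x - y) \<le> r"
  using absv_add_le'[of x r "- y"] by simp

lemma absv_add_less: "absv x < r \<Longrightarrow> absv y < r \<Longrightarrow> absv (x + y) < r"
  using absv_add_le[of x y] by auto

lemma absv_diff_trans_le:
  "absv (x - y) \<le> r \<Longrightarrow> absv (y - z) \<le> r \<Longrightarrow> absv (x - z) \<le> r"
  using absv_add_le'[of "x - y" r "y - z"] by simp

lemma absv_diff_trans_less:
  "absv (x - y) < r \<Longrightarrow> absv (y - z) < r \<Longrightarrow> absv (x - z) < r"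
  using absv_add_less[of "x - y" r "y - z"] by simp

lemma absv_add_eq:
  assumes "absv y < absv x"
  shows "absv (x + y) = absv x"
proof (rule antisym)
  show "absv (x + y) \<le> absv x"
    using absv_add_le[of x y] assms by simp
  show "absv x \<le> absv (x + y)"
    using absv_add_le[of "x + y" "- y"] assms by simp
qed

text \<open>The value group is discrete: there is nothing strictly between consecutive powers of q.
  This is why a lower limit can later be tested by exact equalities.\<close>

lemma absv_less_powi_iff:
  fixes x :: "'a::{finite,field} fls"
  shows "absv x < real CARD('a) powi (n + 1) \<longleftrightarrow> absv x \<le> real CARD('a) powi n"
proof (cases "x = 0")
  case True
  then show ?thesis
    using card_field_gt_1[where 'a='a] by simp
next
  case False
  then show ?thesis
    unfolding absv_nonzero[OF False] powi_le_iff[OF card_field_gt_1] powi_less_iff[OF card_field_gt_1]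
    by auto
qed

section \<open>Polynomials in Y as a discrete subring of the completion\<close>

lemma polyY_0 [simp]: "polyY 0 = 0"
  by (simp add: polyY_def)

lemma polyY_pCons: "polyY (pCons a P) = fls_const a + fls_X_inv * polyY P"
  by (simp add: polyY_def map_poly_pCons)

lemma polyY_nth: "polyY P $$ n = (if n \<le> 0 then coeff P (nat (- n)) else 0)"
proof (induction P arbitrary: n)
  case (pCons a P)
  show ?case
    by (cases "n = 0")
       (auto simp: polyY_pCons fls_X_inv_times_conv_shift pCons.IH coeff_pCons
          Suc_nat_eq_nat_zadd1 nat_diff_distrib' split: nat.splits)
qed simp


lemma polyY_eq_iff [simp]: "polyY P = polyY Q \<longleftrightarrow> P = Q"
proof
  assume *: "polyY P = polyY Q"
  show "P = Q"
  proof (rule poly_eqI)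
    fix n
    have "polyY P $$ (- int n) = polyY Q $$ (- int n)"
      by (simp add: *)
    then show "coeff P n = coeff Q n"
      by (simp add: polyY_nth)
  qed
qed auto

lemma polyY_eq_0_iff [simp]: "polyY P = 0 \<longleftrightarrow> P = 0"
  using polyY_eq_iff[of P 0] by simp

lemma polyY_const: "polyY [:a:] = fls_const a"
  by (simp add: polyY_pCons)

lemma polyY_1 [simp]: "polyY 1 = 1"
  by (simp add: one_pCons polyY_const del: polyY_eq_iff)

lemma polyY_add: "polyY (P + Q) = polyY P + polyY Q"
  by (rule fls_eqI) (simp add: polyY_nth)

lemma polyY_minus: "polyY (- P) = - polyY P"
  by (rule fls_eqI) (simp add: polyY_nth)

lemma polyY_diff: "polyY (P - Q) = polyY P - polyY Q"
  using polyY_add[of P "- Q"] by (simp add: polyY_minus)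

lemma polyY_smult: "polyY (smult a P) = fls_const a * polyY P"
  by (rule fls_eqI) (simp add: polyY_nth)

lemma polyY_mult: "polyY (P * Q) = polyY P * polyY Q"
  by (induction P) (simp_all add: polyY_add polyY_smult polyY_pCons ring_distribs mult.assoc)

lemma polyY_power: "polyY (P ^ n) = polyY P ^ n"
  by (induction n) (auto simp: polyY_mult)

lemmas polyY_simps = polyY_add polyY_minus polyY_diff polyY_mult polyY_power

lemma absv_polyY:
  fixes P :: "'a::{finite,field} poly"
  assumes "P \<noteq> 0"
  shows "absv (polyY P) = real CARD('a) ^ degree P"
proof -
  have "fls_subdegree (polyY P) = - int (degree P)"
    using assms by (intro fls_subdegree_eqI) (auto simp: polyY_nth intro!: coeff_eq_0)
  then show ?thesis
    using assms by (simp add: absv_nonzero)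
qed

lemma absv_polyY_ge_1: "P \<noteq> 0 \<Longrightarrow> 1 \<le> absv (polyY P)"
  using card_field_gt_1 by (simp add: absv_polyY less_imp_le)

lemma absv_polyY_less_1: "absv (polyY P) < 1 \<Longrightarrow> P = 0"
  using absv_polyY_ge_1[of P] by force

lemma absv_polyY_degree_0: "P \<noteq> 0 \<Longrightarrow> degree P = 0 \<Longrightarrow> absv (polyY P) = 1"
  by (simp add: absv_polyY)

lemma polyY_approx:
  fixes x :: "'a::{finite,field} fls"
  obtains P where "absv (x - polyY P) < 1"
proof
  \<comment> \<open>\<open>fls_prpart\<close> collects the coefficients of negative index only, so
    the constant term of the integral part is added separately.\<close>
  let ?P = "fls_prpart x + [:x $$ 0:]"
  have "absv (x - polyY ?P) \<le> real CARD('a) powi (- 1)"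
    unfolding absv_le_iff
  proof (intro allI impI)
    fix i :: int
    assume "i < 1"
    then consider "i = 0" | "i < 0"
      by linarith
    then show "(x - polyY ?P) $$ i = 0"
      by cases (auto simp: polyY_nth coeff_pCons split: nat.splits)
  qed
  also have "\<dots> < 1"
    using card_field_gt_1[where 'a='a] by (simp add: field_simps)
  finally show "absv (x - polyY ?P) < 1" .
qed

text \<open>Discreteness of R, with finitely many elements in each ball: the source of shortest
  vectors in reduction theory and of the finiteness of orbit points at large scale.\<close>

lemma finite_polys_absv_le: "finite {P :: 'a::{finite,field} poly. absv (polyY P) \<le> M}"
proof -
  obtain n where n: "M < real CARD('a) ^ n"
    using real_arch_pow[OF card_field_gt_1[where 'a='a], of M] by blast
  have "P \<in> Poly ` {xs. set xs \<subseteq> UNIV \<and> length xs \<le> n}" if "absv (polyY P) \<le> M" for P :: "'a poly"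
  proof -
    have "length (coeffs P) \<le> n"
    proof (cases "P = 0")
      case False
      with n that have "real CARD('a) ^ degree P < real CARD('a) ^ n"
        by (simp add: absv_polyY)
      then have "degree P < n"
        using card_field_gt_1[where 'a='a] power_less_imp_less_exp by blast
      with False show ?thesis
        by (simp add: length_coeffs_degree)
    qed simp
    moreover have "P = Poly (coeffs P)"
      by simp
    ultimately show ?thesis
      by blast
  qed
  then have "{P. absv (polyY P) \<le> M} \<subseteq> Poly ` {xs :: 'a list. set xs \<subseteq> UNIV \<and> length xs \<le> n}"
    by blast
  then show ?thesis
    by (rule finite_subset) (intro finite_imageI finite_lists_length_le, simp)
qed

lemma inK_iff: "inK x \<longleftrightarrow> (\<exists>P Q. Q \<noteq> 0 \<and> polyY Q * x = polyY P)"
proof -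
  have "x = polyY P / polyY Q \<longleftrightarrow> polyY Q * x = polyY P" if "Q \<noteq> 0" for P Q
    using that by (auto simp: field_simps)
  then show ?thesis
    unfolding inK_def by metis
qed

text \<open>Linear independence of 1 and x over K, the form in which irrationality is used
  throughout.\<close>

lemma not_inK_linear:
  assumes "\<not> inK x" and "polyY a * x + polyY b = 0"
  shows "a = 0" and "b = 0"
proof -
  have "polyY a * x = polyY (- b)"
    using assms(2) by (simp add: polyY_minus eq_neg_iff_add_eq_0)
  with assms(1) show "a = 0"
    unfolding inK_iff by blast
  with assms(2) show "b = 0"
    by simp
qed

lemma linear_form_nonzero:
  assumes "\<not> inK x" and "(c, d) \<noteq> (0, 0)"
  shows "polyY c * x + polyY d \<noteq> 0"
  using not_inK_linear[OF assms(1), of c d] assms(2) by auto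

section \<open>Quadratic power series, conjugation and homographies\<close>

text \<open>The choice in \<open>conj\<close> is harmless: eliminating the square between two
  quadratic relations leaves a linear one, which is trivial for x outside K, so B / A is the same
  for both.\<close>

lemma conj_eq:
  assumes x: "\<not> inK x" and A: "A \<noteq> 0" and root: "polyY A * x\<^sup>2 + polyY B * x + polyY C = 0"
  shows "conj x = - polyY B / polyY A - x"
proof -
  have "- polyY B' / polyY A' - x = - polyY B / polyY A - x"
    if "A' \<noteq> 0" and root': "polyY A' * x\<^sup>2 + polyY B' * x + polyY C' = 0" for A' B' C'
  proof -
    have "polyY (A' * B - A * B') * x + polyY (A' * C - A * C') = 0"
      using root root' unfolding polyY_simps by algebra
    then have "A' * B = A * B'"
      using not_inK_linear(1)[OF x] by fastforce
    then have "polyY A' * polyY B = polyY A * polyY B'"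
      by (metis polyY_mult)
    with A \<open>A' \<noteq> 0\<close> show ?thesis
      by (simp add: field_simps)
  qed
  then show ?thesis
    unfolding conj_def using A root by (intro some_equality) blast+
qed

lemma conj_sum_prod:
  assumes x: "\<not> inK x" and A: "A \<noteq> 0" and root: "polyY A * x\<^sup>2 + polyY B * x + polyY C = 0"
  shows "polyY A * (x + conj x) = - polyY B" and "polyY A * (x * conj x) = polyY C"
proof -
  show sum: "polyY A * (x + conj x) = - polyY B"
    using A by (simp add: conj_eq[OF assms] field_simps)
  have "polyY A * (x * conj x) = x * (polyY A * (x + conj x)) - polyY A * x\<^sup>2"
    by algebra
  also have "\<dots> = polyY C"
    unfolding sum using root by algebra
  finally show "polyY A * (x * conj x) = polyY C" .
qed

text \<open>Converse of Vieta's formulas. A conjugate is recognised by its sum and product with x,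
  so the choice operator never has to be unfolded again.\<close>

lemma conjI_sum_prod:
  assumes x: "\<not> inK x" and A: "A \<noteq> 0"
    and sum: "polyY A * (x + y) = polyY B" and prod: "polyY A * (x * y) = polyY C"
  shows "quadratic x" and "conj x = y"
proof -
  have root: "polyY A * x\<^sup>2 + polyY (- B) * x + polyY C = 0"
    unfolding polyY_minus sum[symmetric] prod[symmetric] by algebra
  with x A show "quadratic x"
    unfolding quadratic_def by blast
  show "conj x = y"
    using A sum by (simp add: conj_eq[OF x A root] polyY_minus field_simps)
qed

lemma quadraticE:
  assumes "quadratic x"
  obtains A B C where "A \<noteq> 0" "polyY A * (x + conj x) = polyY B" "polyY A * (x * conj x) = polyY C"
proof -
  obtain A B C where x: "\<not> inK x" and A: "A \<noteq> 0" and root: "polyY A * x\<^sup>2 + polyY B * x + polyY C = 0"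
    using assms unfolding quadratic_def by blast
  show thesis
    using that[OF A, of "- B" C] conj_sum_prod[OF x A root] by (simp add: polyY_minus)
qed

lemma quadratic_not_inK: "quadratic x \<Longrightarrow> \<not> inK x"
  by (simp add: quadratic_def)

lemma quadratic_conj_involutive:
  assumes "quadratic x"
  shows "quadratic (conj x) \<and> conj (conj x) = x"
proof -
  obtain A B C where *: "A \<noteq> 0" "polyY A * (x + conj x) = polyY B" "polyY A * (x * conj x) = polyY C"
    using quadraticE[OF assms] by blast
  have "\<not> inK (conj x)"
  proof
    assume "inK (conj x)"
    then obtain P Q where Q: "Q \<noteq> 0" "polyY Q * conj x = polyY P"
      unfolding inK_iff by blast
    have "polyY (Q * A) * x = polyY (Q * B - A * P)"
      unfolding polyY_simps *(2)[symmetric] Q(2)[symmetric] by algebra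
    with Q(1) *(1) have "inK x"
      unfolding inK_iff by (metis mult_eq_0_iff)
    with quadratic_not_inK[OF assms] show False
      by blast
  qed
  with * conjI_sum_prod[of "conj x" A x B C] show ?thesis
    by (simp add: ac_simps)
qed

lemmas quadratic_conj = conjunct1[OF quadratic_conj_involutive]
lemmas conj_conj = conjunct2[OF quadratic_conj_involutive]

text \<open>Separability: in characteristic 2, if the square of a series \<open>P + \<phi>\<close> with \<open>P\<close> polynomial
  and \<open>\<bar>\<phi>\<bar> < 1\<close> is a polynomial, then so is \<open>\<phi>\<^sup>2\<close>, whence \<open>\<phi> = 0\<close>.\<close>

lemma conj_neq:
  fixes x :: "'a::{finite,field} fls"
  assumes "quadratic x"
  shows "conj x \<noteq> x"
proof
  assume eq: "conj x = x"
  obtain A B C where A: "A \<noteq> 0" and sum: "polyY A * (x + conj x) = polyY B"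
    and prod: "polyY A * (x * conj x) = polyY C"
    using quadraticE[OF assms] by blast
  \<comment> \<open>With equal roots the relation for the sum becomes linear in x, which forces 2 A
    = 0 and hence characteristic 2.\<close>
  have "polyY (A + A) * x + polyY (- B) = polyY A * (x + conj x) - polyY B"
    unfolding eq polyY_simps by algebra
  also have "\<dots> = 0"
    using sum by simp
  finally have "polyY (A + A) * x + polyY (- B) = 0" .
  then have "A + A = 0"
    using not_inK_linear(1) quadratic_not_inK[OF assms] by blast
  then have "coeff A (degree A) + coeff A (degree A) = 0"
    by (metis coeff_0 coeff_add)
  then have "(2 :: 'a) * lead_coeff A = 0"
    by simp
  then have two: "(2 :: 'a) = 0"
    using A by simp
  have two': "y + y = 0" for y :: "'a fls"
  proof -
    have "y + y = fls_const 2 * y"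
      by simp
    then show ?thesis
      by (simp only: two) simp
  qed
  obtain P where P: "absv (polyY A * x - polyY P) < 1"
    using polyY_approx .
  define \<phi> where "\<phi> = polyY A * x - polyY P"
  have "polyY (A * C) = (polyY P + \<phi>)\<^sup>2"
    by (simp add: \<phi>_def polyY_mult eq prod[symmetric] power2_eq_square)
  also have "\<dots> = (polyY P)\<^sup>2 + \<phi>\<^sup>2 + (polyY P * \<phi> + polyY P * \<phi>)"
    by algebra
  finally have "polyY (A * C - P\<^sup>2) = \<phi>\<^sup>2"
    by (simp add: two' polyY_simps)
  moreover have "absv (\<phi>\<^sup>2) < 1"
    using P by (simp add: absv_power \<phi>_def power_less_one_iff)
  ultimately have "\<phi>\<^sup>2 = 0"
    using absv_polyY_less_1 by (metis polyY_0)
  then have "polyY A * x + polyY (- P) = 0"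
    by (simp add: \<phi>_def polyY_minus)
  with A quadratic_not_inK[OF assms] show False
    using not_inK_linear(1) by blast
qed

section \<open>Homographies and their effect on quadratic series\<close>

definition mob :: "'a::field poly \<Rightarrow> 'a poly \<Rightarrow> 'a poly \<Rightarrow> 'a poly \<Rightarrow> 'a fls \<Rightarrow> 'a fls" where
  "mob a b c d x = (polyY a * x + polyY b) / (polyY c * x + polyY d)"

text \<open>All metric information on homographies comes from this identity: up to the determinant,
  a distance is divided by the two denominators.\<close>

lemma mob_diff:
  assumes "polyY c * x + polyY d \<noteq> 0" and "polyY c * y + polyY d \<noteq> 0"
  shows "mob a b c d x - mob a b c d y =
    polyY (a * d - b * c) * (x - y) / ((polyY c * x + polyY d) * (polyY c * y + polyY d))"
proof -
  have "mob a b c d x - mob a b c d y =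
    ((polyY a * x + polyY b) * (polyY c * y + polyY d) - (polyY a * y + polyY b) * (polyY c * x + polyY d))
     / ((polyY c * x + polyY d) * (polyY c * y + polyY d))"
    unfolding mob_def using assms by (rule diff_frac_eq)
  also have "(polyY a * x + polyY b) * (polyY c * y + polyY d) - (polyY a * y + polyY b) * (polyY c * x + polyY d)
    = polyY (a * d - b * c) * (x - y)"
    unfolding polyY_simps by algebra
  finally show ?thesis .
qed

lemma mob_mob:
  fixes x :: "'a::field fls"
  assumes "polyY c * x + polyY d \<noteq> 0"
  shows "mob a' b' c' d' (mob a b c d x) =
    mob (a' * a + b' * c) (a' * b + b' * d) (c' * a + d' * c) (c' * b + d' * d) x"
proof -
  let ?u = "polyY a * x + polyY b" and ?v = "polyY c * x + polyY d"
  have *: "r * (u / v) + s = (r * u + s * v) / v" if "v \<noteq> 0" for r s u v :: "'a fls"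
    using that by (simp add: field_simps)
  have "mob a' b' c' d' (mob a b c d x) = (polyY a' * ?u + polyY b' * ?v) / (polyY c' * ?u + polyY d' * ?v)"
    unfolding mob_def *[OF assms] using assms by simp
  also have "polyY a' * ?u + polyY b' * ?v = polyY (a' * a + b' * c) * x + polyY (a' * b + b' * d)"
    unfolding polyY_simps by algebra
  also have "polyY c' * ?u + polyY d' * ?v = polyY (c' * a + d' * c) * x + polyY (c' * b + d' * d)"
    unfolding polyY_simps by algebra
  finally show ?thesis
    by (simp only: mob_def)
qed

lemma denom_nonzero:
  assumes "\<not> inK x" and "a * d - b * c \<noteq> 0"
  shows "polyY c * x + polyY d \<noteq> 0"
  using assms by (intro linear_form_nonzero) auto

text \<open>If the image were P / Q, independence of 1 and x would make the row (Q, -P) annihilate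
  both columns of a matrix with nonzero determinant.\<close>

lemma mob_not_inK:
  assumes x: "\<not> inK x" and det: "a * d - b * c \<noteq> 0"
  shows "\<not> inK (mob a b c d x)"
proof
  assume "inK (mob a b c d x)"
  then obtain P Q where Q: "Q \<noteq> 0" "polyY Q * mob a b c d x = polyY P"
    unfolding inK_iff by blast
  then have "polyY Q * (polyY a * x + polyY b) = polyY P * (polyY c * x + polyY d)"
    using denom_nonzero[OF assms] by (simp add: mob_def field_simps)
  then have "polyY (Q * a - P * c) * x + polyY (Q * b - P * d) = 0"
    unfolding polyY_simps by algebra
  then have "Q * a - P * c = 0" "Q * b - P * d = 0"
    using not_inK_linear[OF x] by blast+
  then have "Q * (a * d - b * c) = 0"
    by algebra
  with Q(1) det show False
    by simp
qed

text \<open>\<open>A'\<close> is A times the norm of the denominator c x + d, that is, the leading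
  coefficient of the transformed quadratic form. The claim on the difference says that A (x - conj
  x), a square root of the discriminant, is merely multiplied by the determinant.\<close>

lemma mob_quadratic_form:
  fixes x :: "'a::{finite,field} fls"
  assumes quad: "quadratic x" and det: "a * d - b * c \<noteq> 0"
    and A: "A \<noteq> 0" and sum: "polyY A * (x + conj x) = polyY B" and prod: "polyY A * (x * conj x) = polyY C"
  defines "A' \<equiv> A * d\<^sup>2 + B * c * d + C * c\<^sup>2"
  shows "A' \<noteq> 0" and "quadratic (mob a b c d x)" and "conj (mob a b c d x) = mob a b c d (conj x)"
    and "polyY A' * (mob a b c d x - conj (mob a b c d x)) = polyY A * polyY (a * d - b * c) * (x - conj x)"
    and "\<exists>B'. polyY A' * (mob a b c d x + conj (mob a b c d x)) = polyY B'"
    and "\<exists>C'. polyY A' * (mob a b c d x * conj (mob a b c d x)) = polyY C'"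
proof -
  let ?y = "conj x"
  let ?u = "polyY c * x + polyY d" and ?v = "polyY c * ?y + polyY d"
  let ?p = "polyY a * x + polyY b" and ?r = "polyY a * ?y + polyY b"
  note x = quadratic_not_inK[OF quad] and y = quadratic_not_inK[OF quadratic_conj[OF quad]]
  have uv: "?u \<noteq> 0" "?v \<noteq> 0"
    using denom_nonzero[OF x det] denom_nonzero[OF y det] by auto
  have A': "polyY A' = polyY A * (?u * ?v)"
    unfolding A'_def polyY_simps sum[symmetric] prod[symmetric] by algebra
  with A uv show nz: "A' \<noteq> 0"
    by (metis mult_eq_0_iff polyY_eq_0_iff)
  have *: "k * (u * v) * (p / u + r / v) = k * (p * v + r * u)"
    "k * (u * v) * ((p / u) * (r / v)) = k * (p * r)" if "u \<noteq> 0" "v \<noteq> 0" for k u v p r :: "'a fls"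
    using that by (simp_all add: field_simps)
  have "polyY A' * (?p / ?u + ?r / ?v) = polyY A * (?p * ?v + ?r * ?u)"
    unfolding A' using uv by (rule *)
  also have "\<dots> = polyY (2 * a * c * C + (a * d + b * c) * B + 2 * b * d * A)" (is "_ = polyY ?B")
    unfolding polyY_simps sum[symmetric] prod[symmetric] mult_2 by algebra
  finally have 1: "polyY A' * (mob a b c d x + mob a b c d ?y) = polyY ?B"
    by (simp only: mob_def)
  have "polyY A' * ((?p / ?u) * (?r / ?v)) = polyY A * (?p * ?r)"
    unfolding A' using uv by (rule *)
  also have "\<dots> = polyY (a\<^sup>2 * C + a * b * B + b\<^sup>2 * A)" (is "_ = polyY ?C")
    unfolding polyY_simps sum[symmetric] prod[symmetric] by algebra
  finally have 2: "polyY A' * (mob a b c d x * mob a b c d ?y) = polyY ?C"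
    by (simp only: mob_def)
  show "quadratic (mob a b c d x)" and conj: "conj (mob a b c d x) = mob a b c d ?y"
    using conjI_sum_prod[OF mob_not_inK[OF x det] nz 1 2] by auto
  show "polyY A' * (mob a b c d x - conj (mob a b c d x)) = polyY A * polyY (a * d - b * c) * (x - ?y)"
    unfolding conj mob_diff[OF uv] A' using uv by simp
  show "\<exists>B'. polyY A' * (mob a b c d x + conj (mob a b c d x)) = polyY B'"
    and "\<exists>C'. polyY A' * (mob a b c d x * conj (mob a b c d x)) = polyY C'"
    unfolding conj using 1 2 by blast+
qed

lemma quadratic_mob:
  fixes x :: "'a::{finite,field} fls"
  assumes "quadratic x" and "a * d - b * c \<noteq> 0"
  shows "quadratic (mob a b c d x)" and "conj (mob a b c d x) = mob a b c d (conj x)"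
  using mob_quadratic_form(2,3)[OF assms] quadraticE[OF assms(1)] by metis+

section \<open>The orbit of \<alpha> and its discriminant\<close>

lemma Theta_eq:
  "Theta \<alpha> = {mob a b c d \<gamma> | a b c d \<gamma>. a * d - b * c \<noteq> 0 \<and> degree (a * d - b * c) = 0 \<and>
     \<gamma> \<in> {\<alpha>, conj \<alpha>}}"
  by (simp add: Theta_def mob_def)

lemma Theta_quadratic:
  fixes \<alpha> :: "'a::{finite,field} fls"
  assumes "quadratic \<alpha>" and "\<beta> \<in> Theta \<alpha>"
  shows "quadratic \<beta>"
  using assms quadratic_mob(1) quadratic_conj unfolding Theta_eq by blast

lemma mob_in_Theta:
  fixes \<alpha> :: "'a::{finite,field} fls"
  assumes \<alpha>: "quadratic \<alpha>" and \<beta>: "\<beta> \<in> Theta \<alpha>" and det: "a * d - b * c = 1"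
  shows "mob a b c d \<beta> \<in> Theta \<alpha>"
proof -
  obtain a' b' c' d' \<gamma> where \<beta>': "\<beta> = mob a' b' c' d' \<gamma>"
    and det': "a' * d' - b' * c' \<noteq> 0" "degree (a' * d' - b' * c') = 0" and \<gamma>: "\<gamma> \<in> {\<alpha>, conj \<alpha>}"
    using \<beta> unfolding Theta_eq by blast
  have "\<not> inK \<gamma>"
    using \<gamma> quadratic_not_inK quadratic_conj \<alpha> by blast
  then have eq: "mob a b c d \<beta> =
      mob (a * a' + b * c') (a * b' + b * d') (c * a' + d * c') (c * b' + d * d') \<gamma>"
    unfolding \<beta>' using mob_mob denom_nonzero det'(1) by blast
  have "(a * a' + b * c') * (c * b' + d * d') - (a * b' + b * d') * (c * a' + d * c') =
      (a * d - b * c) * (a' * d' - b' * c')"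
    by algebra
  with det have "(a * a' + b * c') * (c * b' + d * d') - (a * b' + b * d') * (c * a' + d * c') =
      a' * d' - b' * c'"
    by simp
  with det' have "(a * a' + b * c') * (c * b' + d * d') - (a * b' + b * d') * (c * a' + d * c') \<noteq> 0"
    "degree ((a * a' + b * c') * (c * b' + d * d') - (a * b' + b * d') * (c * a' + d * c')) = 0"
    by simp_all
  with eq \<gamma> show ?thesis
    unfolding Theta_eq by blast
qed

text \<open>The number \<open>D\<close> is the absolute value of the square root of the discriminant, an invariant of
  the orbit.\<close>

lemma Theta_form:
  fixes \<alpha> :: "'a::{finite,field} fls"
  assumes \<alpha>: "quadratic \<alpha>"
  obtains D where "0 < D"
    and "\<And>\<beta>. \<beta> \<in> Theta \<alpha> \<Longrightarrow> \<exists>A B C. A \<noteq> 0 \<and> polyY A * (\<beta> + conj \<beta>) = polyY B \<and>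
      polyY A * (\<beta> * conj \<beta>) = polyY C \<and> absv (polyY A) * absv (\<beta> - conj \<beta>) = D"
proof -
  obtain A B C where A: "A \<noteq> 0" and sum: "polyY A * (\<alpha> + conj \<alpha>) = polyY B"
    and prod: "polyY A * (\<alpha> * conj \<alpha>) = polyY C"
    using quadraticE[OF \<alpha>] .
  define D where "D = absv (polyY A) * absv (\<alpha> - conj \<alpha>)"
  have "0 < D"
    using A conj_neq[OF \<alpha>] by (simp add: D_def)
  moreover have "\<exists>A B C. A \<noteq> 0 \<and> polyY A * (\<beta> + conj \<beta>) = polyY B \<and>
      polyY A * (\<beta> * conj \<beta>) = polyY C \<and> absv (polyY A) * absv (\<beta> - conj \<beta>) = D"
    if \<beta>: "\<beta> \<in> Theta \<alpha>" for \<beta>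
  proof -
    obtain a b c d \<gamma> where \<beta>': "\<beta> = mob a b c d \<gamma>"
      and det: "a * d - b * c \<noteq> 0" "degree (a * d - b * c) = 0" and \<gamma>: "\<gamma> \<in> {\<alpha>, conj \<alpha>}"
      using \<beta> unfolding Theta_eq by blast
    have quad: "quadratic \<gamma>" and sum': "polyY A * (\<gamma> + conj \<gamma>) = polyY B"
      and prod': "polyY A * (\<gamma> * conj \<gamma>) = polyY C" and D: "D = absv (polyY A) * absv (\<gamma> - conj \<gamma>)"
      using \<gamma> \<alpha> sum prod quadratic_conj conj_conj[OF \<alpha>]
      by (auto simp: D_def ac_simps absv_minus_commute)
    note * = mob_quadratic_form[OF quad det(1) A sum' prod', folded \<beta>']
    define A' where "A' = A * d\<^sup>2 + B * c * d + C * c\<^sup>2"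
    have "absv (polyY A') * absv (\<beta> - conj \<beta>) = absv (polyY A' * (\<beta> - conj \<beta>))"
      by (simp only: absv_mult)
    also have "\<dots> = absv (polyY A) * absv (polyY (a * d - b * c)) * absv (\<gamma> - conj \<gamma>)"
      unfolding A'_def *(4) by (simp only: absv_mult)
    also have "\<dots> = D"
      unfolding D absv_polyY_degree_0[OF det] by simp
    finally show ?thesis
      using *(1,5,6) unfolding A'_def by blast
  qed
  ultimately show thesis
    by (rule that)
qed

section \<open>The approximation constant\<close>

lemma eventually_Theta_iff:
  "eventually P (inf (filtercomap (\<lambda>\<beta>. absv (\<beta> - conj \<beta>)) (nhds 0)) (principal (Theta \<alpha>))) \<longleftrightarrow>
    (\<exists>\<delta>>0. \<forall>\<beta>\<in>Theta \<alpha>. absv (\<beta> - conj \<beta>) < \<delta> \<longrightarrow> P \<beta>)"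
proof
  assume "eventually P (inf (filtercomap (\<lambda>\<beta>. absv (\<beta> - conj \<beta>)) (nhds 0)) (principal (Theta \<alpha>)))"
  then obtain Q where Q: "eventually Q (nhds (0 :: real))"
    "\<And>\<beta>. Q (absv (\<beta> - conj \<beta>)) \<Longrightarrow> \<beta> \<in> Theta \<alpha> \<Longrightarrow> P \<beta>"
    unfolding eventually_inf_principal eventually_filtercomap by blast
  then obtain \<delta> where \<delta>: "0 < \<delta>" "\<And>x. dist x 0 < \<delta> \<Longrightarrow> Q x"
    unfolding eventually_nhds_metric by blast
  then have "P \<beta>" if "\<beta> \<in> Theta \<alpha>" "absv (\<beta> - conj \<beta>) < \<delta>" for \<beta>
    using that by (intro Q(2)) auto
  with \<delta>(1) show "\<exists>\<delta>>0. \<forall>\<beta>\<in>Theta \<alpha>. absv (\<beta> - conj \<beta>) < \<delta> \<longrightarrow> P \<beta>"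
    by blast
next
  assume "\<exists>\<delta>>0. \<forall>\<beta>\<in>Theta \<alpha>. absv (\<beta> - conj \<beta>) < \<delta> \<longrightarrow> P \<beta>"
  then obtain \<delta> where \<delta>: "0 < \<delta>" "\<And>\<beta>. \<beta> \<in> Theta \<alpha> \<Longrightarrow> absv (\<beta> - conj \<beta>) < \<delta> \<Longrightarrow> P \<beta>"
    by blast
  show "eventually P (inf (filtercomap (\<lambda>\<beta>. absv (\<beta> - conj \<beta>)) (nhds 0)) (principal (Theta \<alpha>)))"
    unfolding eventually_inf_principal eventually_filtercomap
  proof (intro exI conjI allI impI)
    show "eventually (\<lambda>x. dist x 0 < \<delta>) (nhds (0 :: real))"
      using \<delta>(1) unfolding eventually_nhds_metric by blast
  qed (use \<delta>(2) in auto)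
qed

lemma absv_mult_powi_less_iff:
  fixes x y :: "'a::{finite,field} fls"
  assumes "y \<noteq> 0"
  shows "absv x < real CARD('a) powi (n + 1) * absv y \<longleftrightarrow> absv x \<le> real CARD('a) powi n * absv y"
proof -
  have *: "real CARD('a) powi k * absv y = real CARD('a) powi (k - fls_subdegree y)" for k
    using assms by (simp add: absv_nonzero power_int_diff power_int_minus divide_inverse)
  show ?thesis
    using absv_less_powi_iff[of x "n - fls_subdegree y"] unfolding * by (simp add: algebra_simps)
qed

text \<open>The ratios are 0 or powers of q, so \<open>\<kappa>\<close> is isolated among the
  possible values, and the lower limit can equal it only by being reached at arbitrarily small
  scales.\<close>

lemma c_alpha_eq_iff:
  fixes \<alpha> f :: "'a::{finite,field} fls" and n :: int
  assumes \<alpha>: "quadratic \<alpha>"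
  defines "\<kappa> \<equiv> real CARD('a) powi n"
  shows "c_alpha \<alpha> f = ereal \<kappa> \<longleftrightarrow>
    (\<exists>\<delta>>0. \<forall>\<beta>\<in>Theta \<alpha>. absv (\<beta> - conj \<beta>) < \<delta> \<longrightarrow> \<kappa> * absv (\<beta> - conj \<beta>) \<le> absv (f - \<beta>)) \<and>
    (\<forall>\<delta>>0. \<exists>\<beta>\<in>Theta \<alpha>. absv (\<beta> - conj \<beta>) < \<delta> \<and> absv (f - \<beta>) = \<kappa> * absv (\<beta> - conj \<beta>))"
    (is "_ \<longleftrightarrow> ?low \<and> ?freq")
proof -
  let ?F = "inf (filtercomap (\<lambda>\<beta>. absv (\<beta> - conj \<beta>)) (nhds 0)) (principal (Theta \<alpha>))"
  let ?X = "\<lambda>\<beta>. ereal (absv (f - \<beta>) / absv (\<beta> - conj \<beta>))"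
  let ?q = "real CARD('a)"
  have nz: "\<beta> - conj \<beta> \<noteq> 0" if "\<beta> \<in> Theta \<alpha>" for \<beta>
    using conj_neq[OF Theta_quadratic[OF \<alpha> that]] by auto
  have pos: "0 < absv (\<beta> - conj \<beta>)" if "\<beta> \<in> Theta \<alpha>" for \<beta>
    using nz[OF that] by simp
  have step: "?q powi k < ?q powi (k + 1)" for k
    using powi_less_iff[OF card_field_gt_1[where 'a='a]] by simp
  have le_iff: "ereal c \<le> ?X \<beta> \<longleftrightarrow> c * absv (\<beta> - conj \<beta>) \<le> absv (f - \<beta>)" if "\<beta> \<in> Theta \<alpha>" for c \<beta>
    using pos_le_divide_eq[OF pos[OF that]] by simp
  have less_iff: "ereal c < ?X \<beta> \<longleftrightarrow> c * absv (\<beta> - conj \<beta>) < absv (f - \<beta>)" if "\<beta> \<in> Theta \<alpha>" for c \<beta>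
    using pos_less_divide_eq[OF pos[OF that]] by simp
  have discrete: "?q powi (k + 1) * absv (\<beta> - conj \<beta>) \<le> absv (f - \<beta>)"
    if "\<beta> \<in> Theta \<alpha>" and "?q powi k * absv (\<beta> - conj \<beta>) < absv (f - \<beta>)" for k \<beta>
    using absv_mult_powi_less_iff[OF nz[OF that(1)], of "f - \<beta>" k] that(2) by linarith
  have low_iff: "?low \<longleftrightarrow> eventually (\<lambda>\<beta>. ereal \<kappa> \<le> ?X \<beta>) ?F"
    unfolding eventually_Theta_iff by (simp only: le_iff cong: ball_cong)
  have 1: "?low" if c: "c_alpha \<alpha> f = ereal \<kappa>"
  proof -
    \<comment> \<open>The lower limit only yields strict inequalities, so the next smaller power of
      q is used; discreteness then lifts the strict bound to \<kappa>.\<close>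
    have "eventually (\<lambda>\<beta>. ereal (?q powi (n - 1)) < ?X \<beta>) ?F"
      using c step[of "n - 1"] by (intro less_LiminfD) (simp add: c_alpha_def \<kappa>_def)
    then obtain \<delta> where \<delta>: "0 < \<delta>" "\<And>\<beta>. \<beta> \<in> Theta \<alpha> \<Longrightarrow> absv (\<beta> - conj \<beta>) < \<delta> \<Longrightarrow>
        ?q powi (n - 1) * absv (\<beta> - conj \<beta>) < absv (f - \<beta>)"
      unfolding eventually_Theta_iff using less_iff by blast
    have "\<kappa> * absv (\<beta> - conj \<beta>) \<le> absv (f - \<beta>)"
      if "\<beta> \<in> Theta \<alpha>" "absv (\<beta> - conj \<beta>) < \<delta>" for \<beta>
      using discrete[OF that(1) \<delta>(2)[OF that]] by (simp add: \<kappa>_def)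
    with \<delta>(1) show ?thesis
      by blast
  qed
  have 2: "?freq" if c: "c_alpha \<alpha> f = ereal \<kappa>"
  proof (rule ccontr)
    assume "\<not> ?freq"
    then obtain \<delta> where \<delta>: "0 < \<delta>" "\<And>\<beta>. \<beta> \<in> Theta \<alpha> \<Longrightarrow> absv (\<beta> - conj \<beta>) < \<delta> \<Longrightarrow>
        absv (f - \<beta>) \<noteq> \<kappa> * absv (\<beta> - conj \<beta>)"
      by blast
    obtain \<delta>' where \<delta>': "0 < \<delta>'" "\<And>\<beta>. \<beta> \<in> Theta \<alpha> \<Longrightarrow> absv (\<beta> - conj \<beta>) < \<delta>' \<Longrightarrow>
        \<kappa> * absv (\<beta> - conj \<beta>) \<le> absv (f - \<beta>)"
      using 1[OF c] by blast
    \<comment> \<open>If \<kappa> is missed at all small scales, the ratio jumps to at least the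
      next power, and so would the lower limit.\<close>
    have "ereal (?q powi (n + 1)) \<le> ?X \<beta>"
      if \<beta>: "\<beta> \<in> Theta \<alpha>" "absv (\<beta> - conj \<beta>) < min \<delta> \<delta>'" for \<beta>
    proof -
      have "\<kappa> * absv (\<beta> - conj \<beta>) < absv (f - \<beta>)"
        using \<beta> \<delta>(2)[of \<beta>] \<delta>'(2)[of \<beta>] by simp
      then show ?thesis
        unfolding le_iff[OF \<beta>(1)] \<kappa>_def by (rule discrete[OF \<beta>(1)])
    qed
    moreover have "0 < min \<delta> \<delta>'"
      using \<delta>(1) \<delta>'(1) by simp
    ultimately have "eventually (\<lambda>\<beta>. ereal (?q powi (n + 1)) \<le> ?X \<beta>) ?F"
      unfolding eventually_Theta_iff by blast
    then have "ereal (?q powi (n + 1)) \<le> c_alpha \<alpha> f"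
      unfolding c_alpha_def by (rule Liminf_bounded)
    with c step[of n] show False
      by (simp add: \<kappa>_def)
  qed
  have 3: "c_alpha \<alpha> f = ereal \<kappa>" if low: ?low and freq: ?freq
  proof (rule antisym)
    show "ereal \<kappa> \<le> c_alpha \<alpha> f"
      unfolding c_alpha_def using low low_iff by (intro Liminf_bounded) blast
    show "c_alpha \<alpha> f \<le> ereal \<kappa>"
    proof (rule ccontr)
      assume "\<not> c_alpha \<alpha> f \<le> ereal \<kappa>"
      then have "eventually (\<lambda>\<beta>. ereal \<kappa> < ?X \<beta>) ?F"
        unfolding c_alpha_def by (intro less_LiminfD) simp
      then obtain \<delta> where \<delta>: "0 < \<delta>" "\<And>\<beta>. \<beta> \<in> Theta \<alpha> \<Longrightarrow> absv (\<beta> - conj \<beta>) < \<delta> \<Longrightarrow>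
          \<kappa> * absv (\<beta> - conj \<beta>) < absv (f - \<beta>)"
        unfolding eventually_Theta_iff using less_iff by blast
      with freq show False
        by (metis less_irrefl)
    qed
  qed
  show ?thesis
    using 1 2 3 by blast
qed

text \<open>The product of |A| and |\<beta> - conj \<beta>| is the invariant D, so a lower bound on
  the second factor bounds A. Then A \<beta> and A conj \<beta> are bounded, hence also B and C;
  only finitely many quadratic equations remain, each with finitely many roots.\<close>

lemma finite_Theta_bounded:
  fixes \<alpha> :: "'a::{finite,field} fls"
  assumes \<alpha>: "quadratic \<alpha>" and "0 < \<delta>" and "0 < M"
  shows "finite {\<beta> \<in> Theta \<alpha>. \<delta> \<le> absv (\<beta> - conj \<beta>) \<and> absv \<beta> \<le> M}"
proof -
  obtain D where D: "0 < D" and form: "\<And>\<beta>. \<beta> \<in> Theta \<alpha> \<Longrightarrow> \<exists>A B C. A \<noteq> 0 \<and>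
      polyY A * (\<beta> + conj \<beta>) = polyY B \<and> polyY A * (\<beta> * conj \<beta>) = polyY C \<and>
      absv (polyY A) * absv (\<beta> - conj \<beta>) = D"
    using Theta_form[OF \<alpha>] by metis
  define a where "a = D / \<delta>"
  define M' where "M' = max a (max (max (a * M) D) (max (a * M) D * M))"
  define S where "S = {P :: 'a poly. absv (polyY P) \<le> M'}"
  have "finite S"
    unfolding S_def by (rule finite_polys_absv_le)
  have root: "\<exists>A\<in>S - {0}. \<exists>B\<in>S. \<exists>C\<in>S. poly [:polyY C, - polyY B, polyY A:] \<beta> = 0"
    if \<beta>: "\<beta> \<in> Theta \<alpha>" "\<delta> \<le> absv (\<beta> - conj \<beta>)" "absv \<beta> \<le> M" for \<beta>
  proof -
    obtain A B C where A: "A \<noteq> 0" and B: "polyY A * (\<beta> + conj \<beta>) = polyY B"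
      and C: "polyY A * (\<beta> * conj \<beta>) = polyY C" and disc: "absv (polyY A) * absv (\<beta> - conj \<beta>) = D"
      using form[OF \<beta>(1)] by blast
    have "absv (polyY A) * \<delta> \<le> D"
      unfolding disc[symmetric] using \<beta>(2) by (intro mult_left_mono) auto
    then have a: "absv (polyY A) \<le> a"
      using \<open>0 < \<delta>\<close> by (simp add: a_def field_simps)
    then have Ab: "absv (polyY A * \<beta>) \<le> a * M"
      unfolding absv_mult using \<beta>(3) by (intro mult_mono) (auto intro: order_trans[OF absv_nonneg])
    \<comment> \<open>The conjugate is controlled through A \<beta>, because the term subtracted has
      absolute value exactly D.\<close>
    have "absv (polyY A * \<beta> - polyY A * (\<beta> - conj \<beta>)) \<le> max (a * M) D"
      using Ab disc by (intro absv_diff_le') (simp_all add: absv_mult)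
    then have Ab': "absv (polyY A * conj \<beta>) \<le> max (a * M) D"
      by (simp add: algebra_simps)
    have "absv (polyY B) \<le> max (a * M) D"
      unfolding B[symmetric] distrib_left using Ab Ab' by (intro absv_add_le') auto
    moreover have "absv (polyY A * conj \<beta> * \<beta>) \<le> max (a * M) D * M"
      unfolding absv_mult[of _ \<beta>] using Ab' \<beta>(3) D by (intro mult_mono) auto
    then have "absv (polyY C) \<le> max (a * M) D * M"
      unfolding C[symmetric] by (simp add: ac_simps)
    ultimately have "A \<in> S" "B \<in> S" "C \<in> S"
      using a by (simp_all only: S_def M'_def mem_Collect_eq le_max_iff_disj simp_thms)
    moreover have "poly [:polyY C, - polyY B, polyY A:] \<beta> = 0"
      unfolding B[symmetric] C[symmetric] by (simp add: algebra_simps)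
    ultimately show ?thesis
      using A by blast
  qed
  have "{\<beta> \<in> Theta \<alpha>. \<delta> \<le> absv (\<beta> - conj \<beta>) \<and> absv \<beta> \<le> M} \<subseteq>
      (\<Union>A\<in>S - {0}. \<Union>B\<in>S. \<Union>C\<in>S. {x. poly [:polyY C, - polyY B, polyY A:] x = 0})"
    unfolding subset_iff UN_iff mem_Collect_eq by (intro allI impI, elim conjE, rule root)
  moreover have "finite \<dots>"
    using \<open>finite S\<close> by (intro finite_UN_I finite_Diff poly_roots_finite) auto
  ultimately show ?thesis
    by (rule finite_subset)
qed

text \<open>A lower bound at a scale \<open>R\<close> rather than at the scale of \<open>\<beta>\<close> itself: this form is
  inherited by other points whose orbit stays close to that of \<open>f\<close> near the scale \<open>R\<close>.\<close>

lemma Theta_uniform_lower_bound: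
  fixes \<alpha> f :: "'a::{finite,field} fls"
  assumes \<alpha>: "quadratic \<alpha>" and f: "f \<notin> Theta \<alpha>" and "0 < \<kappa>" and "0 < \<delta>"
    and low: "\<And>\<beta>. \<beta> \<in> Theta \<alpha> \<Longrightarrow> absv (\<beta> - conj \<beta>) < \<delta> \<Longrightarrow> \<kappa> * absv (\<beta> - conj \<beta>) \<le> absv (f - \<beta>)"
  obtains R0 where "0 < R0"
    and "\<And>R \<beta>. R \<le> R0 \<Longrightarrow> \<beta> \<in> Theta \<alpha> \<Longrightarrow> R \<le> absv (\<beta> - conj \<beta>) \<Longrightarrow> \<kappa> * R \<le> absv (f - \<beta>)"
proof -
  define M where "M = max 1 (absv f)"
  define T where "T = {\<beta> \<in> Theta \<alpha>. \<delta> \<le> absv (\<beta> - conj \<beta>) \<and> absv \<beta> \<le> M}"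
  have "finite T"
    unfolding T_def using \<alpha> \<open>0 < \<delta>\<close> by (intro finite_Theta_bounded) (auto simp: M_def)
  \<comment> \<open>Positive because f lies outside the orbit. The entry 1 covers the \<beta> at
    distance more than 1 from f, which need not lie in the finite set \<open>T\<close>. All
    exceptional \<beta> are thus at distance at least \<mu>, which suffices once \<kappa> R is at
    most \<mu>.\<close>
  define \<mu> where "\<mu> = Min (insert 1 ((\<lambda>\<beta>. absv (f - \<beta>)) ` T))"
  have "0 < \<mu>"
    using \<open>finite T\<close> f by (auto simp: \<mu>_def T_def)
  have "\<mu> \<le> 1" and \<mu>: "\<And>\<beta>. \<beta> \<in> T \<Longrightarrow> \<mu> \<le> absv (f - \<beta>)"
    using \<open>finite T\<close> by (auto simp: \<mu>_def intro!: Min_le)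
  show thesis
  proof
    show "0 < \<mu> / \<kappa>"
      using \<open>0 < \<mu>\<close> \<open>0 < \<kappa>\<close> by simp
    show "\<kappa> * R \<le> absv (f - \<beta>)" if R: "R \<le> \<mu> / \<kappa>" "\<beta> \<in> Theta \<alpha>" "R \<le> absv (\<beta> - conj \<beta>)" for R \<beta>
    proof (cases "absv (\<beta> - conj \<beta>) < \<delta>")
      case True
      have "\<kappa> * R \<le> \<kappa> * absv (\<beta> - conj \<beta>)"
        using R \<open>0 < \<kappa>\<close> by simp
      with low[OF R(2) True] show ?thesis
        by simp
    next
      case False
      have "\<mu> \<le> absv (f - \<beta>)"
      proof (cases "absv (f - \<beta>) \<le> 1")
        case True
        then have "absv \<beta> \<le> M"
          using absv_diff_le'[of f M "f - \<beta>"] by (simp add: M_def)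
        with False R(2) show ?thesis
          by (intro \<mu>) (simp add: T_def)
      qed (use \<open>\<mu> \<le> 1\<close> in auto)
      moreover have "\<kappa> * R \<le> \<mu>"
        using R(1) \<open>0 < \<kappa>\<close> by (simp add: field_simps)
      ultimately show ?thesis
        by simp
    qed
  qed
qed

section \<open>Reduction theory\<close>

text \<open>Bezout: a nonzero element of least degree in the ideal generated by c and d divides both
  by Euclidean division, so primitivity makes it a constant, which is scaled to 1.\<close>

lemma primitive_pair_completion:
  fixes c d :: "'a::field poly"
  assumes nz: "(c, d) \<noteq> (0, 0)"
    and prim: "\<And>g c' d'. c = g * c' \<Longrightarrow> d = g * d' \<Longrightarrow> degree g = 0"
  obtains a b where "a * d - b * c = 1"
proof -
  define I where "I = {a * d - b * c | a b. True} - {0}"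
  have "\<exists>g. g \<in> I"
  proof (cases "c = 0")
    case True
    then have "d = 1 * d - 0 * c" "d \<noteq> 0"
      using nz by auto
    then show ?thesis
      unfolding I_def by blast
  next
    case False
    have "c = 0 * d - (- 1) * c"
      by simp
    with False show ?thesis
      unfolding I_def by blast
  qed
  then obtain g where g: "g \<in> I" and min: "\<And>h. h \<in> I \<Longrightarrow> degree g \<le> degree h"
    using ex_has_least_nat[of "\<lambda>g. g \<in> I" _ degree] by metis
  obtain a b where ab: "g = a * d - b * c" and "g \<noteq> 0"
    using g unfolding I_def by blast
  have small: "x = 0" if "x = a' * d - b' * c" "x = 0 \<or> degree x < degree g" for x a' b'
    using that min[of x] unfolding I_def by fastforce
  have "c mod g = (- (c div g) * a) * d - (- 1 - (c div g) * b) * c"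
    unfolding minus_div_mult_eq_mod[symmetric] ab by algebra
  then have "c mod g = 0"
    using small degree_mod_less[OF \<open>g \<noteq> 0\<close>] by blast
  moreover have "d mod g = (1 - (d div g) * a) * d - (- (d div g) * b) * c"
    unfolding minus_div_mult_eq_mod[symmetric] ab by algebra
  then have "d mod g = 0"
    using small degree_mod_less[OF \<open>g \<noteq> 0\<close>] by blast
  ultimately have "degree g = 0"
    using prim[of g "c div g" "d div g"] by (simp add: mod_eq_0_iff_dvd)
  then obtain u where u: "g = [:u:]"
    using degree_eq_zeroE by blast
  have "smult (inverse u) a * d - smult (inverse u) b * c = smult (inverse u) g"
    by (simp add: ab smult_diff_right)
  also have "\<dots> = 1"
    using u \<open>g \<noteq> 0\<close> by (simp add: one_pCons)
  finally show thesis
    by (rule that)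
qed

text \<open>For the norm \<open>(c, d) \<mapsto> max \<bar>c f + d\<bar> (\<bar>c\<bar> \<rho>)\<close>, attached to the ball of center \<open>f\<close> and
  radius \<open>\<rho>\<close>, a shortest vector completes to an orthogonal basis, and by orthogonality
  the two lengths multiply to \<open>\<rho>\<close>.\<close>

lemma reduced_basis:
  fixes f :: "'a::{finite,field} fls"
  assumes f: "\<not> inK f" and \<rho>: "0 < \<rho>"
  obtains N a b c d where "0 < N" and "N = max (absv (polyY c * f + polyY d)) (absv (polyY c) * \<rho>)"
    and "(c, d) \<noteq> (0, 0)" and "a * d - b * c = 1"
    and "absv (polyY a * f + polyY b) \<le> \<rho> / N" "absv (polyY c * f + polyY d) \<le> \<rho> / N"
    and "absv (polyY a) \<le> 1 / N" "absv (polyY c) \<le> 1 / N"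
proof -
  define L where "L c d = max (absv (polyY c * f + polyY d)) (absv (polyY c) * \<rho>)" for c d
  define T where "T = {(c, d). (c, d) \<noteq> (0, 0) \<and> L c d \<le> 1}"
  define S where "S = {P :: 'a poly. absv (polyY P) \<le> max (1 / \<rho>) (max 1 (1 / \<rho> * absv f))}"
  have "T \<subseteq> S \<times> S"
  proof clarify
    fix c d
    assume "(c, d) \<in> T"
    then have *: "absv (polyY c * f + polyY d) \<le> 1" "absv (polyY c) * \<rho> \<le> 1"
      by (auto simp: T_def L_def)
    then have c: "absv (polyY c) \<le> 1 / \<rho>"
      using \<rho> by (simp add: field_simps)
    then have "absv (polyY c * f) \<le> 1 / \<rho> * absv f"
      unfolding absv_mult by (intro mult_right_mono) auto
    then have "absv ((polyY c * f + polyY d) - polyY c * f) \<le> max 1 (1 / \<rho> * absv f)"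
      using *(1) by (intro absv_diff_le') (simp_all add: le_max_iff_disj)
    then show "c \<in> S \<and> d \<in> S"
      using c by (simp add: S_def le_max_iff_disj)
  qed
  moreover have "finite S"
    unfolding S_def by (rule finite_polys_absv_le)
  ultimately have "finite T"
    by (meson finite_SigmaI finite_subset)
  \<comment> \<open>This vector has norm 1, so a minimum over the finite set of nonzero vectors of
    norm at most 1 is a minimum over all nonzero vectors.\<close>
  have "(0, 1) \<in> T"
    by (simp add: T_def L_def)
  define N where "N = Min (case_prod L ` T)"
  have "N \<in> case_prod L ` T"
    unfolding N_def using \<open>finite T\<close> \<open>(0, 1) \<in> T\<close> by (intro Min_in) auto
  then obtain c d where N: "N = L c d" and "(c, d) \<in> T"
    by auto
  then have nz: "(c, d) \<noteq> (0, 0)" and "N \<le> 1"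
    by (auto simp: T_def)
  have min: "N \<le> L c' d'" if "(c', d') \<noteq> (0, 0)" for c' d'
  proof (cases "L c' d' \<le> 1")
    case True
    with that have "(c', d') \<in> T"
      by (simp add: T_def)
    then show ?thesis
      unfolding N_def using \<open>finite T\<close> by (intro Min_le) auto
  qed (use \<open>N \<le> 1\<close> in linarith)
  have "polyY c * f + polyY d \<noteq> 0"
    by (rule linear_form_nonzero[OF f nz])
  then have "0 < N"
    by (simp add: N L_def less_max_iff_disj)
  \<comment> \<open>Dividing out a common factor of positive degree would give a shorter
    vector.\<close>
  have "degree g = 0" if g: "c = g * c'" "d = g * d'" for g c' d'
  proof (rule ccontr)
    assume "degree g \<noteq> 0"
    have "g \<noteq> 0" "(c', d') \<noteq> (0, 0)"
      using nz g by auto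
    have "N = absv (polyY g) * L c' d'"
      unfolding N L_def g polyY_mult mult.assoc distrib_left[symmetric] absv_mult
      using max_mult_distrib_left[of "absv (polyY g)"] by simp
    moreover have "1 < absv (polyY g)"
      using \<open>degree g \<noteq> 0\<close> \<open>g \<noteq> 0\<close> card_field_gt_1[where 'a='a] by (simp add: absv_polyY one_less_power)
    moreover have "N \<le> L c' d'"
      by (rule min) fact
    ultimately show False
      using \<open>0 < N\<close> by (smt (verit) mult_less_cancel_right1)
  qed
  then obtain a0 b0 where det0: "a0 * d - b0 * c = 1"
    using primitive_pair_completion[OF nz] by blast
  have det: "(a0 - t * c) * d - (b0 - t * d) * c = 1" for t
    using det0 by algebra
  have nz': "(a, b) \<noteq> (0, 0)" if "a * d - b * c = 1" for a b
    using that by auto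
  have det': "polyY a * (polyY c * f + polyY d) - polyY c * (polyY a * f + polyY b) = 1"
    if "a * d - b * c = 1" for a b
  proof -
    have "polyY (a * d - b * c) = 1"
      by (simp add: that)
    then show ?thesis
      unfolding polyY_simps by algebra
  qed
  show thesis
  proof (cases "absv (polyY c) * \<rho> \<le> absv (polyY c * f + polyY d)")
    case True
    define v where "v = polyY c * f + polyY d"
    have v: "absv v = N" "v \<noteq> 0"
      using True \<open>0 < N\<close> by (auto simp: v_def N L_def)
    \<comment> \<open>Size reduction in the coordinate where (c, d) attains its norm. The reduced
      vector is small there, so by minimality it attains its norm in the other coordinate; then one
      term dominates the determinant, whose value 1 fixes the product of the two lengths.\<close>
    obtain t where t: "absv ((polyY a0 * f + polyY b0) / v - polyY t) < 1"
      using polyY_approx .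
    define a b where "a = a0 - t * c" and "b = b0 - t * d"
    define u where "u = polyY a * f + polyY b"
    have "u = ((polyY a0 * f + polyY b0) / v - polyY t) * v"
      using v by (simp add: u_def a_def b_def polyY_simps field_simps) (simp add: v_def algebra_simps)
    then have u: "absv u < N"
      using t v \<open>0 < N\<close> by (simp add: absv_mult)
    have 1: "a * d - b * c = 1"
      unfolding a_def b_def by (rule det)
    have "N \<le> max (absv u) (absv (polyY a) * \<rho>)"
      using min[OF nz'[OF 1]] by (simp add: L_def u_def)
    with u have a: "N \<le> absv (polyY a) * \<rho>"
      by linarith
    have c: "absv (polyY c) * \<rho> \<le> N"
      using True v by (simp add: v_def)
    with a \<rho> have "absv (polyY c) \<le> absv (polyY a)"
      by (meson mult_le_cancel_right_pos order_trans)
    then have "absv (polyY c * u) \<le> absv (polyY a) * absv u"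
      unfolding absv_mult by (rule mult_right_mono) simp
    also have "\<dots> < absv (polyY a) * N"
      using u a \<open>0 < N\<close> \<rho> by (intro mult_strict_left_mono) (auto simp: absv_nonneg intro: ccontr)
    finally have "absv (- (polyY c * u)) < absv (polyY a * v)"
      by (simp add: absv_mult v)
    from absv_add_eq[OF this] have aN: "absv (polyY a) * N = 1"
      using det'[OF 1] by (simp add: v absv_mult flip: u_def v_def)
    have a1: "absv (polyY a) = 1 / N"
      using aN \<open>0 < N\<close> by (simp add: field_simps)
    have N\<rho>: "N \<le> \<rho> / N"
      using a unfolding a1 by simp
    have "N / \<rho> \<le> 1 / N"
      using N\<rho> \<rho> \<open>0 < N\<close> by (simp add: field_simps)
    moreover have "absv (polyY c) \<le> N / \<rho>"
      using c \<rho> by (simp add: field_simps)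
    ultimately have c1: "absv (polyY c) \<le> 1 / N"
      by simp
    show thesis
      by (rule that[of N c d a b]) (use \<open>0 < N\<close> nz 1 N u v N\<rho> a1 c1 in \<open>auto simp: L_def u_def v_def\<close>)
  next
    case False
    then have c: "absv (polyY c) * \<rho> = N"
      by (simp add: N L_def)
    with \<open>0 < N\<close> have "polyY c \<noteq> 0"
      by auto
    define v where "v = polyY c * f + polyY d"
    have v: "absv v < N"
      using False c by (simp add: v_def)
    \<comment> \<open>The same reduction with the two coordinates exchanged.\<close>
    obtain t where t: "absv (polyY a0 / polyY c - polyY t) < 1"
      using polyY_approx .
    define a b where "a = a0 - t * c" and "b = b0 - t * d"
    define u where "u = polyY a * f + polyY b"
    have "polyY a = (polyY a0 / polyY c - polyY t) * polyY c"
      using \<open>polyY c \<noteq> 0\<close> by (simp add: a_def polyY_simps left_diff_distrib)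
    then have a: "absv (polyY a) < absv (polyY c)"
      using t \<open>polyY c \<noteq> 0\<close> by (simp add: absv_mult)
    have 1: "a * d - b * c = 1"
      unfolding a_def b_def by (rule det)
    have "N \<le> max (absv u) (absv (polyY a) * \<rho>)"
      using min[OF nz'[OF 1]] by (simp add: L_def u_def)
    moreover have "absv (polyY a) * \<rho> < N"
      using a c \<rho> by auto
    ultimately have u: "N \<le> absv u"
      by linarith
    have "absv (polyY a * v) \<le> absv (polyY a) * absv u"
      unfolding absv_mult using u v by (intro mult_left_mono) auto
    also have "\<dots> < absv (polyY c) * absv u"
      using a u \<open>0 < N\<close> by (intro mult_strict_right_mono) auto
    finally have "absv (polyY a * v) < absv (- (polyY c * u))"
      by (simp add: absv_mult)
    from absv_add_eq[OF this] have cu: "absv (polyY c) * absv u = 1"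
      using det'[OF 1] by (simp add: absv_mult flip: u_def v_def)
    have c1: "absv (polyY c) = N / \<rho>"
      using c \<rho> by (simp add: field_simps)
    have u1: "absv u = \<rho> / N"
      using cu \<rho> \<open>0 < N\<close> unfolding c1 by (simp add: field_simps)
    have N\<rho>: "N \<le> \<rho> / N"
      using u unfolding u1 .
    have "N / \<rho> \<le> 1 / N"
      using N\<rho> \<rho> \<open>0 < N\<close> by (simp add: field_simps)
    then have "absv (polyY c) \<le> 1 / N" "absv (polyY a) \<le> 1 / N"
      using a c1 by auto
    then show thesis
      by (intro that[of N c d a b]) (use \<open>0 < N\<close> nz 1 N u1 v N\<rho> in \<open>auto simp: L_def u_def v_def\<close>)
  qed
qed

text \<open>The ball of radius \<rho> about f contains \<beta> and its conjugate, so the quadratic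
  form of \<beta> at the shortest vector is at most |A| N^2. Being a nonzero polynomial it is at
  least 1 in absolute value. Hence N^2 is at least |\<beta> - conj \<beta>| / D, and the estimates
  of \<open>reduced_basis\<close> acquire bounds without N.\<close>

lemma Theta_reduction:
  fixes \<beta> f :: "'a::{finite,field} fls"
  assumes f: "\<not> inK f" and \<beta>: "\<not> inK \<beta>" and \<beta>': "\<not> inK (conj \<beta>)" and "conj \<beta> \<noteq> \<beta>"
    and A: "A \<noteq> 0" and B: "polyY A * (\<beta> + conj \<beta>) = polyY B" and C: "polyY A * (\<beta> * conj \<beta>) = polyY C"
    and D: "absv (polyY A) * absv (\<beta> - conj \<beta>) = D"
    and \<rho>: "absv (\<beta> - conj \<beta>) \<le> \<rho>" "absv (f - \<beta>) \<le> \<rho>"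
  obtains a b c d where "a * d - b * c = 1"
    and "(absv (polyY a * f + polyY b))\<^sup>2 * absv (\<beta> - conj \<beta>) \<le> D * \<rho>\<^sup>2"
    and "(absv (polyY c * f + polyY d))\<^sup>2 * absv (\<beta> - conj \<beta>) \<le> D * \<rho>\<^sup>2"
    and "(absv (polyY a))\<^sup>2 * absv (\<beta> - conj \<beta>) \<le> D" "(absv (polyY c))\<^sup>2 * absv (\<beta> - conj \<beta>) \<le> D"
proof -
  define r where "r = absv (\<beta> - conj \<beta>)"
  have "0 < r"
    using \<open>conj \<beta> \<noteq> \<beta>\<close> by (simp add: r_def)
  then have "0 < \<rho>"
    using \<rho>(1) unfolding r_def by (rule less_le_trans)
  obtain N a b c d where "0 < N" and N: "N = max (absv (polyY c * f + polyY d)) (absv (polyY c) * \<rho>)"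
    and nz: "(c, d) \<noteq> (0, 0)" and det: "a * d - b * c = 1"
    and *: "absv (polyY a * f + polyY b) \<le> \<rho> / N" "absv (polyY c * f + polyY d) \<le> \<rho> / N"
       "absv (polyY a) \<le> 1 / N" "absv (polyY c) \<le> 1 / N"
    using reduced_basis[OF f \<open>0 < \<rho>\<close>] .
  have cN: "absv (polyY c * x) \<le> N" if "absv x \<le> \<rho>" for x
  proof -
    have "absv (polyY c * x) \<le> absv (polyY c) * \<rho>"
      unfolding absv_mult using that by (intro mult_left_mono) auto
    then show ?thesis
      by (simp add: N)
  qed
  have "absv ((polyY c * f + polyY d) - polyY c * (f - \<beta>)) \<le> N"
    using \<rho>(2) cN by (intro absv_diff_le') (simp_all add: N)
  then have 1: "absv (polyY c * \<beta> + polyY d) \<le> N"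
    by (simp add: algebra_simps)
  have "absv ((polyY c * \<beta> + polyY d) - polyY c * (\<beta> - conj \<beta>)) \<le> N"
    using \<rho>(1) cN 1 by (intro absv_diff_le') simp_all
  then have 2: "absv (polyY c * conj \<beta> + polyY d) \<le> N"
    by (simp add: algebra_simps)
  have "polyY A * ((polyY c * \<beta> + polyY d) * (polyY c * conj \<beta> + polyY d)) =
      polyY (A * d\<^sup>2 + B * c * d + C * c\<^sup>2)" (is "_ = polyY ?Q")
    unfolding polyY_simps B[symmetric] C[symmetric] by algebra
  moreover have "polyY A * ((polyY c * \<beta> + polyY d) * (polyY c * conj \<beta> + polyY d)) \<noteq> 0"
    using A linear_form_nonzero[OF \<beta> nz] linear_form_nonzero[OF \<beta>' nz] by simp
  ultimately have "1 \<le> absv (polyY A * ((polyY c * \<beta> + polyY d) * (polyY c * conj \<beta> + polyY d)))"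
    using absv_polyY_ge_1[of ?Q] by (metis polyY_0)
  also have "\<dots> \<le> absv (polyY A) * (N * N)"
    unfolding absv_mult using 1 2 \<open>0 < N\<close> by (intro mult_left_mono mult_mono) auto
  finally have "1 * r \<le> absv (polyY A) * (N * N) * r"
    using \<open>0 < r\<close> by (intro mult_right_mono) auto
  also have "\<dots> = D * N\<^sup>2"
    by (simp add: D[symmetric] r_def power2_eq_square)
  finally have r: "r \<le> D * N\<^sup>2"
    by simp
  have bound: "x\<^sup>2 * r \<le> D * y\<^sup>2" if "x \<le> y / N" "0 \<le> x" for x y
  proof -
    have "x\<^sup>2 * r \<le> (y / N)\<^sup>2 * (D * N\<^sup>2)"
      using that r \<open>0 < r\<close> by (intro mult_mono power_mono) auto
    then show ?thesis
      using \<open>0 < N\<close> by (simp add: power_divide mult.commute)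
  qed
  show thesis
    using that[OF det] bound[OF *(1)] bound[OF *(2)] bound[OF *(3)] bound[OF *(4)]
    by (simp add: r_def)
qed

section \<open>Approximate periods\<close>

text \<open>Total boundedness, with a finite window of coefficients as label: coefficients before
  the window vanish on the whole ball, and those after it contribute at most \<epsilon>.\<close>

lemma finite_ball_partition:
  fixes M \<epsilon> :: real
  assumes "0 < \<epsilon>"
  obtains t :: "'a::{finite,field} fls \<Rightarrow> int \<Rightarrow> 'a"
  where "finite (t ` {x. absv x \<le> M})"
    and "\<And>x y. absv x \<le> M \<Longrightarrow> absv y \<le> M \<Longrightarrow> t x = t y \<Longrightarrow> absv (x - y) \<le> \<epsilon>"
proof -
  let ?q = "real CARD('a)"
  obtain m where m: "M < ?q ^ m"
    using real_arch_pow[OF card_field_gt_1[where 'a='a], of M] by blast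
  obtain n where n: "1 / \<epsilon> < ?q ^ n"
    using real_arch_pow[OF card_field_gt_1[where 'a='a], of "1 / \<epsilon>"] by blast
  define J where "J = {- int m..<int n}"
  define t :: "'a fls \<Rightarrow> int \<Rightarrow> 'a" where "t x = restrict (fls_nth x) J" for x
  have "t ` {x. absv x \<le> M} \<subseteq> J \<rightarrow>\<^sub>E UNIV"
    by (auto simp: t_def)
  moreover have "finite (J \<rightarrow>\<^sub>E (UNIV :: 'a set))"
    by (intro finite_PiE) (auto simp: J_def)
  ultimately have "finite (t ` {x. absv x \<le> M})"
    by (rule finite_subset)
  moreover have "absv (x - y) \<le> \<epsilon>" if x: "absv x \<le> M" and y: "absv y \<le> M" and eq: "t x = t y" for x y
  proof -
    have "absv (x - y) \<le> ?q powi (- int n)"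
      unfolding absv_le_iff
    proof (intro allI impI)
      fix i
      assume "i < int n"
      show "(x - y) $$ i = 0"
      proof (cases "i \<in> J")
        case True
        then have "x $$ i = y $$ i"
          using fun_cong[OF eq, of i] by (simp add: t_def)
        then show ?thesis
          by simp
      next
        case False
        have "absv z \<le> ?q powi (- (- int m))" if "absv z \<le> M" for z :: "'a fls"
          using that m by simp
        from this[OF x] this[OF y] have "x $$ i = 0" "y $$ i = 0"
          unfolding absv_le_iff using False \<open>i < int n\<close> by (auto simp: J_def)
        then show ?thesis
          by simp
      qed
    qed
    also have "\<dots> \<le> \<epsilon>"
      using n assms by (simp add: power_int_minus field_simps)
    finally show ?thesis .
  qed
  ultimately show thesis
    by (rule that)
qed

text \<open>If \<open>h s \<in> SL\<^sub>2\<close> reduces the ball of center \<open>f\<close> and radius \<open>r s\<close>, then, suitably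
  rescaled by a series \<open>\<tau> s\<close> with \<open>\<bar>\<tau> s\<bar>\<^sup>2\<close> comparable to \<open>r s\<close>, the pair (matrix, ball) ranges
  over a bounded set.  Two scales \<open>k < l\<close> with nearly equal data yield the matrix
  \<open>inverse (h l) * h k\<close>, which nearly maps the ball at scale \<open>k\<close> to the one at scale \<open>l\<close>.\<close>

lemma approximate_period:
  fixes f :: "'a::{finite,field} fls" and S :: "int set"
  defines "r \<equiv> \<lambda>s. real CARD('a) powi (- s)"
  assumes "infinite S" and "0 < \<epsilon>"
    and red: "\<And>s. s \<in> S \<Longrightarrow> \<exists>a b c d. a * d - b * c = 1 \<and>
      (absv (polyY a * f + polyY b))\<^sup>2 \<le> E * r s \<and> (absv (polyY c * f + polyY d))\<^sup>2 \<le> E * r s \<and>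
      (absv (polyY a))\<^sup>2 * r s \<le> E \<and> (absv (polyY c))\<^sup>2 * r s \<le> E"
  obtains k l a b c d where "k \<in> S" "l \<in> S" "k < l" "a * d - b * c = 1"
    and "(absv (polyY c * f + polyY d))\<^sup>2 * r l = r k"
    and "absv (polyY c) * r k \<le> \<epsilon> * absv (polyY c * f + polyY d)"
    and "absv (mob a b c d f - f) \<le> \<epsilon> * r l"
proof -
  let ?q = "real CARD('a)"
  note q = card_field_gt_1[where 'a='a]
  have r_pos: "0 < r s" for s
    using q by (simp add: r_def)
  \<comment> \<open>An approximate square root of the scale: its squared absolute value is
    \<open>r s\<close> for even s and q times that for odd s.\<close>
  define \<tau> :: "int \<Rightarrow> 'a fls" where "\<tau> s = fls_X_intpow (s div 2)" for s
  have \<tau>_nz: "\<tau> s \<noteq> 0" for s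
    by (simp add: \<tau>_def)
  have \<tau>: "(absv (\<tau> s))\<^sup>2 = ?q powi (s mod 2) * r s" for s
  proof -
    have "(absv (\<tau> s))\<^sup>2 = ?q powi (- (s div 2) * 2)"
      unfolding \<tau>_def absv_fls_X_intpow power_int_mult by simp
    also have "- (s div 2) * 2 = s mod 2 + - s"
      using minus_mult_div_eq_mod[of s 2] by linarith
    also have "?q powi \<dots> = ?q powi (s mod 2) * r s"
      unfolding r_def using q by (intro power_int_add) simp
    finally show ?thesis .
  qed
  have "?q powi (s mod 2) = 1 \<or> ?q powi (s mod 2) = ?q" for s
    by (cases "even s") (auto simp: odd_iff_mod_2_eq_one even_iff_mod_2_eq_zero)
  then have "1 \<le> ?q powi (s mod 2)" "?q powi (s mod 2) \<le> ?q" for s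
    using q by (metis less_imp_le order_refl)+
  then have \<tau>_ge: "r s \<le> (absv (\<tau> s))\<^sup>2" and \<tau>_le: "(absv (\<tau> s))\<^sup>2 \<le> ?q * r s" for s
    unfolding \<tau> using r_pos[of s] by (simp_all add: mult_le_cancel_right)
  obtain a b c d where det: "\<And>s. s \<in> S \<Longrightarrow> a s * d s - b s * c s = 1"
    and bounds: "\<And>s. s \<in> S \<Longrightarrow> (absv (polyY (a s) * f + polyY (b s)))\<^sup>2 \<le> E * r s"
      "\<And>s. s \<in> S \<Longrightarrow> (absv (polyY (c s) * f + polyY (d s)))\<^sup>2 \<le> E * r s"
      "\<And>s. s \<in> S \<Longrightarrow> (absv (polyY (a s)))\<^sup>2 * r s \<le> E"
      "\<And>s. s \<in> S \<Longrightarrow> (absv (polyY (c s)))\<^sup>2 * r s \<le> E"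
    using red by metis
  define U V A C where "U s = (polyY (a s) * f + polyY (b s)) / \<tau> s"
    and "V s = (polyY (c s) * f + polyY (d s)) / \<tau> s"
    and "A s = polyY (a s) * \<tau> s" and "C s = polyY (c s) * \<tau> s" for s
  define M where "M = sqrt (?q * E)"
  have "0 \<le> E"
  proof -
    obtain s where "s \<in> S"
      using \<open>infinite S\<close> by fastforce
    have "0 \<le> (absv (polyY (a s)))\<^sup>2 * r s"
      using r_pos[of s] by simp
    with bounds(3)[OF \<open>s \<in> S\<close>] show ?thesis
      by linarith
  qed
  have M1: "absv (x / \<tau> s) \<le> M" if "(absv x)\<^sup>2 \<le> E * r s" for x s
  proof -
    have "(absv (x / \<tau> s))\<^sup>2 * (absv (\<tau> s))\<^sup>2 = (absv x)\<^sup>2"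
      using \<tau>_nz[of s] by (simp add: absv_divide power_divide)
    also have "\<dots> \<le> E * r s"
      by fact
    also have "\<dots> \<le> E * (absv (\<tau> s))\<^sup>2"
      using \<tau>_ge[of s] \<open>0 \<le> E\<close> by (rule mult_left_mono)
    finally have "(absv (x / \<tau> s))\<^sup>2 \<le> E"
      using \<tau>_nz[of s] by (simp add: mult_le_cancel_right)
    also have "\<dots> \<le> ?q * E"
      using q \<open>0 \<le> E\<close> by (simp add: mult_le_cancel_right1)
    finally show ?thesis
      unfolding M_def by (rule real_le_rsqrt)
  qed
  have M2: "absv (x * \<tau> s) \<le> M" if "(absv x)\<^sup>2 * r s \<le> E" for x s
  proof -
    have "(absv (x * \<tau> s))\<^sup>2 = (absv x)\<^sup>2 * (absv (\<tau> s))\<^sup>2"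
      by (simp add: absv_mult power_mult_distrib)
    also have "\<dots> \<le> (absv x)\<^sup>2 * (?q * r s)"
      using \<tau>_le[of s] by (rule mult_left_mono) simp
    also have "\<dots> = ?q * ((absv x)\<^sup>2 * r s)"
      by simp
    also have "\<dots> \<le> ?q * E"
      using that q by (intro mult_left_mono) auto
    finally show ?thesis
      unfolding M_def by (rule real_le_rsqrt)
  qed
  have M: "absv (U s) \<le> M" "absv (V s) \<le> M" "absv (A s) \<le> M" "absv (C s) \<le> M" if "s \<in> S" for s
    unfolding U_def V_def A_def C_def using bounds[OF that] by (simp_all only: M1 M2)
  \<comment> \<open>\<open>M + 1\<close> absorbs a factor from the bounded data, \<open>?q\<close>
    the defect of \<tau>, and 1/2 keeps the perturbation strictly below 1, so that it cannot change
    an absolute value equal to 1.\<close>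
  define \<epsilon>' where "\<epsilon>' = min \<epsilon> (1 / 2) / ?q / (M + 1)"
  have "0 \<le> M"
    using q \<open>0 \<le> E\<close> by (simp add: M_def)
  then have "0 < \<epsilon>'"
    using \<open>0 < \<epsilon>\<close> q by (simp add: \<epsilon>'_def)
  have "M * \<epsilon>' \<le> (M + 1) * \<epsilon>'"
    using \<open>0 < \<epsilon>'\<close> by simp
  also have "\<dots> = min \<epsilon> (1 / 2) / ?q"
    using \<open>0 \<le> M\<close> by (simp add: \<epsilon>'_def)
  finally have "M * \<epsilon>' \<le> min \<epsilon> (1 / 2) / ?q" .
  then have M\<epsilon>'_q: "M * \<epsilon>' * ?q \<le> min \<epsilon> (1 / 2)"
    using q by (simp add: field_simps)
  moreover have "M * \<epsilon>' \<le> M * \<epsilon>' * ?q"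
    using \<open>0 \<le> M\<close> \<open>0 < \<epsilon>'\<close> q by (simp add: mult_le_cancel_left1 not_less)
  ultimately have M\<epsilon>': "M * \<epsilon>' < 1" "M * \<epsilon>' \<le> \<epsilon>" "M * \<epsilon>' * ?q \<le> \<epsilon>"
    by auto
  obtain t :: "'a fls \<Rightarrow> int \<Rightarrow> 'a" where t: "finite (t ` {x. absv x \<le> M})"
    and t_eq: "\<And>x y. absv x \<le> M \<Longrightarrow> absv y \<le> M \<Longrightarrow> t x = t y \<Longrightarrow> absv (x - y) \<le> \<epsilon>'"
    using finite_ball_partition[OF \<open>0 < \<epsilon>'\<close>] by blast
  \<comment> \<open>With the parity of s in the label, the defects of \<tau> at the two scales
    cancel and the ratio of scales comes out exactly.\<close>
  define state where "state s = (s mod 2, t (U s), t (V s), t (A s), t (C s))" for s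
  let ?T = "t ` {x. absv x \<le> M}"
  have "s mod 2 = 0 \<or> s mod 2 = 1" for s :: int
    by presburger
  then have "state s \<in> {0, 1} \<times> ?T \<times> ?T \<times> ?T \<times> ?T" if "s \<in> S" for s
    unfolding state_def using M[OF that] by (intro SigmaI imageI) auto
  then have "state ` S \<subseteq> {0, 1} \<times> ?T \<times> ?T \<times> ?T \<times> ?T"
    by (rule image_subsetI)
  then have "finite (state ` S)"
    by (rule finite_subset) (intro finite_cartesian_product t, simp)
  then obtain s0 where "s0 \<in> S" "infinite {s \<in> S. state s = state s0}"
    using pigeonhole_infinite[OF \<open>infinite S\<close>] by blast
  then obtain k l where kl: "k < l" and S: "k \<in> S" "l \<in> S" and state: "state k = state l"
  proof -
    let ?S0 = "{s \<in> S. state s = state s0}"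
    have "infinite (?S0 - {s0})"
      using \<open>infinite ?S0\<close> by simp
    then obtain x where "x \<in> ?S0 - {s0}"
      using infinite_imp_nonempty by blast
    then have "x \<in> S" "state x = state s0" "x \<noteq> s0"
      by auto
    with that[of x s0] that[of s0 x] \<open>s0 \<in> S\<close> show ?thesis
      by (cases "x < s0") auto
  qed
  have par: "k mod 2 = l mod 2" and close: "absv (U k - U l) \<le> \<epsilon>'" "absv (V k - V l) \<le> \<epsilon>'"
      "absv (A k - A l) \<le> \<epsilon>'" "absv (C k - C l) \<le> \<epsilon>'"
    using state M[OF S(1)] M[OF S(2)] unfolding state_def by (simp_all add: t_eq)
  have cross: "absv (x * y - z * w) \<le> M * \<epsilon>'"
    if "absv x \<le> M" "absv z \<le> M" "absv y \<le> \<epsilon>'" "absv w \<le> \<epsilon>'" for x y z w :: "'a fls"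
    unfolding diff_conv_add_uminus using that \<open>0 \<le> M\<close>
    by (intro absv_add_le') (simp_all add: absv_mult mult_mono)
  define a' b' c' d' where "a' = d l * a k - b l * c k" and "b' = d l * b k - b l * d k"
    and "c' = a l * c k - c l * a k" and "d' = a l * d k - c l * b k"
  define v where "v = polyY c' * f + polyY d'"
  have det': "a' * d' - b' * c' = 1"
  proof -
    have "a' * d' - b' * c' = (a k * d k - b k * c k) * (a l * d l - b l * c l)"
      unfolding a'_def b'_def c'_def d'_def by algebra
    then show ?thesis
      using det S by simp
  qed
  have detl: "A l * V l - C l * U l = 1"
  proof -
    have "A l * V l - C l * U l = polyY (a l * d l - b l * c l)"
      unfolding A_def V_def C_def U_def polyY_simps using \<tau>_nz[of l] by (simp add: field_simps)
    then show ?thesis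
      using det S by simp
  qed
  \<comment> \<open>After rescaling, the denominator is a perturbation of the determinant
    \<open>A l * V l - C l * U l = 1\<close>, so its absolute value is exactly 1. In the same way
    the lower left entry and the displacement of f are determinants of nearly equal columns, hence
    small.\<close>
  have "v * \<tau> l / \<tau> k = A l * V k - C l * U k"
    unfolding v_def c'_def d'_def A_def V_def C_def U_def polyY_simps
    using \<tau>_nz[of k] by (simp add: field_simps)
  also have "\<dots> = 1 + (A l * (V k - V l) - C l * (U k - U l))"
    using detl by (simp add: algebra_simps)
  finally have "absv (v * \<tau> l / \<tau> k) = absv (1 + (A l * (V k - V l) - C l * (U k - U l)))"
    by simp
  also have "\<dots> = 1"
    using le_less_trans[OF cross M\<epsilon>'(1)] M S close by (subst absv_add_eq) simp_all
  finally have v: "absv v = absv (\<tau> k) / absv (\<tau> l)"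
    using \<tau>_nz[of k] \<tau>_nz[of l] by (simp add: absv_mult absv_divide field_simps)
  have 1: "(absv v)\<^sup>2 * r l = r k"
    unfolding v power_divide \<tau> par using q r_pos[of l] by simp
  have "polyY c' * (\<tau> k * \<tau> l) = A l * C k - C l * A k"
    unfolding c'_def A_def C_def polyY_simps by (simp add: algebra_simps)
  also have "\<dots> = A l * (C k - C l) - C l * (A k - A l)"
    by (simp add: algebra_simps)
  finally have "absv (polyY c' * (\<tau> k * \<tau> l)) \<le> M * \<epsilon>'"
    using cross M S close by simp
  then have c': "absv (polyY c') * (absv (\<tau> k) * absv (\<tau> l)) \<le> \<epsilon>"
    using M\<epsilon>'(2) by (simp add: absv_mult)
  have "absv (polyY c') * r k \<le> absv (polyY c') * (absv (\<tau> k))\<^sup>2"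
    using \<tau>_ge[of k] by (intro mult_left_mono) auto
  also have "\<dots> = absv (polyY c') * (absv (\<tau> k) * absv (\<tau> l)) * absv v"
    unfolding v using \<tau>_nz[of l] by (simp add: power2_eq_square)
  also have "\<dots> \<le> \<epsilon> * absv v"
    using c' by (intro mult_right_mono) auto
  finally have 2: "absv (polyY c') * r k \<le> \<epsilon> * absv v" .
  have "v \<noteq> 0"
    using v \<tau>_nz by (metis absv_eq_0_iff divide_eq_0_iff)
  have "(mob a' b' c' d' f - f) * v = (polyY a' * f + polyY b') - f * v"
    unfolding mob_def v_def[symmetric] using \<open>v \<noteq> 0\<close> by (simp add: left_diff_distrib)
  also have "\<dots> = (\<tau> k * \<tau> l) * (V l * U k - U l * V k)"
    unfolding v_def a'_def b'_def c'_def d'_def V_def U_def polyY_simps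
    using \<tau>_nz[of k] \<tau>_nz[of l] by (simp add: field_simps)
  also have "V l * U k - U l * V k = V l * (U k - U l) - U l * (V k - V l)"
    by (simp add: algebra_simps)
  finally have "absv (mob a' b' c' d' f - f) * absv v =
      absv (\<tau> k) * absv (\<tau> l) * absv (V l * (U k - U l) - U l * (V k - V l))"
    by (simp flip: absv_mult)
  also have "\<dots> \<le> absv (\<tau> k) * absv (\<tau> l) * (M * \<epsilon>')"
    using cross M S close by (intro mult_left_mono) auto
  also have "\<dots> = (absv (\<tau> l))\<^sup>2 * (M * \<epsilon>') * absv v"
    unfolding v using \<tau>_nz[of l] by (simp add: power2_eq_square)
  finally have "absv (mob a' b' c' d' f - f) \<le> (absv (\<tau> l))\<^sup>2 * (M * \<epsilon>')"
    using \<open>v \<noteq> 0\<close> by simp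
  also have "\<dots> \<le> (?q * r l) * (M * \<epsilon>')"
    using \<tau>_le[of l] \<open>0 \<le> M\<close> \<open>0 < \<epsilon>'\<close> by (intro mult_right_mono) auto
  also have "\<dots> = M * \<epsilon>' * ?q * r l"
    by simp
  also have "\<dots> \<le> \<epsilon> * r l"
    using M\<epsilon>'(3) r_pos[of l] by (intro mult_right_mono) auto
  finally have 3: "absv (mob a' b' c' d' f - f) \<le> \<epsilon> * r l" .
  show thesis
    using that[OF S kl det'] 1 2 3 by (simp add: v_def)
qed

section \<open>Fixed points\<close>

lemma absv_ge_nth:
  fixes x :: "'a::{finite,field} fls"
  assumes "x $$ i \<noteq> 0"
  shows "real CARD('a) powi (- i) \<le> absv x"
proof -
  have "x \<noteq> 0" "fls_subdegree x \<le> i"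
    using assms by (auto intro: fls_subdegree_leI)
  then show ?thesis
    unfolding absv_nonzero[OF \<open>x \<noteq> 0\<close>] powi_le_iff[OF card_field_gt_1] by simp
qed

text \<open>Completeness, argued coefficientwise: terms that differ at index i are at distance at
  least q^(-i), so each coefficient is eventually constant. A common bound on the terms makes the
  supports uniformly bounded below, so the limit is again a Laurent series.\<close>

lemma fls_geometric_limit:
  fixes z :: "nat \<Rightarrow> 'a::{finite,field} fls"
  assumes step: "\<And>n. absv (z (Suc n) - z n) \<le> K * \<theta> ^ n" and "0 < K" and \<theta>: "0 < \<theta>" "\<theta> < 1"
  obtains w where "\<And>n. absv (z n - w) \<le> K * \<theta> ^ n"
proof -
  let ?q = "real CARD('a)"
  note q = card_field_gt_1[where 'a='a]
  have tail: "absv (z (n + p) - z n) \<le> K * \<theta> ^ n" for n p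
  proof (induction p)
    case (Suc p)
    have "absv (z (Suc (n + p)) - z (n + p)) \<le> K * \<theta> ^ (n + p)"
      by (rule step)
    also have "\<dots> \<le> K * \<theta> ^ n"
      using \<theta> \<open>0 < K\<close> by (intro mult_left_mono power_decreasing) auto
    finally show ?case
      using Suc absv_diff_trans_le by fastforce
  qed (use \<open>0 < K\<close> \<theta> in simp)
  have "\<exists>m. \<forall>p\<ge>m. z p $$ i = z m $$ i" for i
  proof -
    obtain m where m: "\<theta> ^ m < ?q powi (- i) / K"
      using real_arch_pow_inv[of "?q powi (- i) / K" \<theta>] \<theta> \<open>0 < K\<close> q by auto
    have "z p $$ i = z m $$ i" if "m \<le> p" for p
    proof (rule ccontr)
      assume "z p $$ i \<noteq> z m $$ i"
      then have "?q powi (- i) \<le> absv (z p - z m)"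
        by (intro absv_ge_nth) simp
      also have "\<dots> \<le> K * \<theta> ^ m"
        using tail[of m "p - m"] that by simp
      finally show False
        using m \<open>0 < K\<close> by (simp add: field_simps)
    qed
    then show ?thesis
      by blast
  qed
  then obtain m where m: "\<And>i p. m i \<le> p \<Longrightarrow> z p $$ i = z (m i) $$ i"
    by metis
  obtain N where N: "max (absv (z 0)) K < ?q ^ N"
    using real_arch_pow[OF q] by blast
  have "absv (z n) \<le> ?q powi (- (- int N))" for n
  proof -
    have "absv ((z n - z 0) + z 0) \<le> max (absv (z 0)) K"
      using tail[of 0 n] by (intro absv_add_le') auto
    also have "\<dots> \<le> ?q ^ N"
      using N by (rule less_imp_le)
    finally show ?thesis
      by simp
  qed
  then have z_zero: "z n $$ i = 0" if "i < - int N" for n i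
    using that unfolding absv_le_iff by blast
  define w where "w = Abs_fls (\<lambda>i. z (m i) $$ i)"
  have w: "w $$ i = z (m i) $$ i" for i
    unfolding w_def by (rule nth_Abs_fls_lower_bound[of "- int N"]) (simp add: z_zero)
  have "absv (z n - w) \<le> K * \<theta> ^ n" for n
  proof (cases "z n = w")
    case False
    define i where "i = fls_subdegree (z n - w)"
    \<comment> \<open>By index p the coefficient at the leading index i of the difference has
      stabilised, so the distance from \<open>z n\<close> to the limit is already seen between two
      terms.\<close>
    define p where "p = m i + n"
    have nz: "z n - w \<noteq> 0"
      using False by simp
    have "(z n - w) $$ i \<noteq> 0"
      unfolding i_def by (rule nth_fls_subdegree_nonzero[OF nz])
    then have "(z n - z p) $$ i \<noteq> 0"
      using m[of i p] by (simp add: w p_def)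
    then have "absv (z n - w) \<le> absv (z n - z p)"
      unfolding absv_nonzero[OF nz] i_def[symmetric] by (rule absv_ge_nth)
    also have "\<dots> \<le> K * \<theta> ^ n"
      using tail[of n "m i"] by (simp add: p_def absv_minus_commute add.commute)
    finally show ?thesis .
  qed (use \<open>0 < K\<close> \<theta> in simp)
  then show thesis
    by (rule that)
qed

lemma absv_mob_diff:
  fixes x y :: "'a::{finite,field} fls"
  assumes det: "a * d - b * c = 1"
    and "polyY c * x + polyY d \<noteq> 0" and "polyY c * y + polyY d \<noteq> 0"
  shows "absv (mob a b c d x - mob a b c d y) =
    absv (x - y) / (absv (polyY c * x + polyY d) * absv (polyY c * y + polyY d))"
  using mob_diff[OF assms(2,3), of a b] by (simp add: det absv_divide absv_mult)

text \<open>Denominators have constant absolute value on small balls, so homographies of determinant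
  1 act there as exact similarities.\<close>

lemma absv_affine_eq:
  fixes x y :: "'a::{finite,field} fls"
  assumes "absv (polyY c) * absv (x - y) < absv (polyY c * y + polyY d)"
  shows "absv (polyY c * x + polyY d) = absv (polyY c * y + polyY d)"
proof -
  have "absv ((polyY c * y + polyY d) + polyY c * (x - y)) = absv (polyY c * y + polyY d)"
    using assms by (intro absv_add_eq) (simp add: absv_mult)
  then show ?thesis
    by (simp add: algebra_simps)
qed

text \<open>On the ball of radius \<delta> about f every denominator has the absolute value l of the
  one at f, so the homography contracts by exactly 1 / l^2 and, by \<open>near\<close>, maps the
  ball to itself. The fixed point is the limit of the iterates of f.\<close>

lemma attracting_fixed_point:
  fixes f :: "'a::{finite,field} fls"
  assumes det: "a * d - b * c = 1" and \<lambda>: "1 < absv (polyY c * f + polyY d)" and "0 < \<delta>"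
    and near: "absv (mob a b c d f - f) \<le> \<delta>"
    and c: "absv (polyY c) * \<delta> < absv (polyY c * f + polyY d)"
  obtains z where "mob a b c d z = z" and "absv (f - z) \<le> \<delta>"
    and "absv (polyY c * z + polyY d) = absv (polyY c * f + polyY d)"
proof -
  define l where "l = absv (polyY c * f + polyY d)"
  define \<theta> where "\<theta> = 1 / l\<^sup>2"
  have "1 < l"
    using \<lambda> by (simp add: l_def)
  then have \<theta>: "0 < \<theta>" "\<theta> < 1"
    by (simp_all add: \<theta>_def)
  have den: "absv (polyY c * x + polyY d) = l" if "absv (x - f) \<le> \<delta>" for x
  proof -
    have "absv (polyY c) * absv (x - f) \<le> absv (polyY c) * \<delta>"
      using that by (intro mult_left_mono) auto
    with c show ?thesis
      unfolding l_def by (intro absv_affine_eq) simp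
  qed
  have contr: "absv (mob a b c d x - mob a b c d y) = \<theta> * absv (x - y)"
    if "absv (x - f) \<le> \<delta>" "absv (y - f) \<le> \<delta>" for x y
  proof -
    have "polyY c * x + polyY d \<noteq> 0" "polyY c * y + polyY d \<noteq> 0"
      using den[OF that(1)] den[OF that(2)] \<open>1 < l\<close> by auto
    from absv_mob_diff[OF det this] show ?thesis
      by (simp add: den that \<theta>_def power2_eq_square)
  qed
  have inv: "absv (mob a b c d x - f) \<le> \<delta>" if "absv (x - f) \<le> \<delta>" for x
  proof -
    have "absv (mob a b c d x - mob a b c d f) = \<theta> * absv (x - f)"
      using that \<open>0 < \<delta>\<close> by (intro contr) auto
    also have "\<dots> \<le> 1 * \<delta>"
      using \<theta> that by (intro mult_mono) auto
    finally show ?thesis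
      using near absv_diff_trans_le by fastforce
  qed
  define z where "z n = (mob a b c d ^^ n) f" for n
  have z: "absv (z n - f) \<le> \<delta>" for n
    by (induction n) (use inv \<open>0 < \<delta>\<close> in \<open>auto simp: z_def\<close>)
  have "absv (z (Suc n) - z n) \<le> \<delta> * \<theta> ^ n" for n
  proof (induction n)
    case (Suc n)
    have "absv (z (Suc (Suc n)) - z (Suc n)) = \<theta> * absv (z (Suc n) - z n)"
      using contr[OF z z, of "Suc n" n] by (simp add: z_def)
    also have "\<dots> \<le> \<theta> * (\<delta> * \<theta> ^ n)"
      using Suc \<theta> by (intro mult_left_mono) auto
    finally show ?case
      by (simp add: ac_simps)
  qed (use near in \<open>simp add: z_def\<close>)
  then obtain w where w: "\<And>n. absv (z n - w) \<le> \<delta> * \<theta> ^ n"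
    using fls_geometric_limit[of z \<delta> \<theta>] \<open>0 < \<delta>\<close> \<theta> by metis
  have wf: "absv (w - f) \<le> \<delta>"
    using w[of 0] by (simp add: z_def absv_minus_commute)
  have fixed_approx: "absv (mob a b c d w - w) \<le> \<delta> * \<theta> ^ n" for n
  proof (rule absv_diff_trans_le)
    have "absv (mob a b c d w - z (Suc n)) = \<theta> * absv (w - z n)"
      using contr[OF wf z, of n] by (simp add: z_def)
    also have "\<dots> \<le> 1 * absv (w - z n)"
      using \<theta> by (intro mult_right_mono) auto
    also have "\<dots> \<le> \<delta> * \<theta> ^ n"
      using w[of n] by (simp add: absv_minus_commute)
    finally show "absv (mob a b c d w - z (Suc n)) \<le> \<delta> * \<theta> ^ n" .
    have "\<delta> * \<theta> ^ Suc n \<le> \<delta> * \<theta> ^ n"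
      using \<theta> \<open>0 < \<delta>\<close> by (intro mult_left_mono power_decreasing) auto
    with w[of "Suc n"] show "absv (z (Suc n) - w) \<le> \<delta> * \<theta> ^ n"
      by (rule order_trans)
  qed
  have "mob a b c d w - w = 0"
  proof (rule ccontr)
    assume "mob a b c d w - w \<noteq> 0"
    then have "0 < absv (mob a b c d w - w) / \<delta>"
      using \<open>0 < \<delta>\<close> by simp
    then obtain n where "\<theta> ^ n < absv (mob a b c d w - w) / \<delta>"
      using real_arch_pow_inv \<theta>(2) by blast
    with fixed_approx[of n] \<open>0 < \<delta>\<close> show False
      by (simp add: field_simps)
  qed
  then show thesis
    using wf den[OF wf] by (intro that[of w]) (simp_all add: l_def absv_minus_commute)
qed

text \<open>(z, 1) is an eigenvector with eigenvalue c z + d; as the determinant is 1, the other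
  eigenvalue a - c z is its inverse.\<close>

lemma fixed_point_eigenvalue:
  assumes det: "a * d - b * c = 1" and fix_z: "mob a b c d z = z" and nz: "polyY c * z + polyY d \<noteq> 0"
  shows "(polyY a - polyY c * z) * (polyY c * z + polyY d) = 1"
    and "polyY c * z\<^sup>2 + polyY (d - a) * z + polyY (- b) = 0"
proof -
  have eq: "polyY a * z + polyY b = z * (polyY c * z + polyY d)"
    using fix_z nz unfolding mob_def by (simp add: field_simps)
  then show "polyY c * z\<^sup>2 + polyY (d - a) * z + polyY (- b) = 0"
    unfolding polyY_simps by algebra
  have "polyY a * polyY d - polyY b * polyY c = 1"
    using arg_cong[OF det, of polyY] by (simp add: polyY_simps)
  with eq show "(polyY a - polyY c * z) * (polyY c * z + polyY d) = 1"
    by algebra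
qed

text \<open>Irrationality by descent: the inverse matrix multiplies the vector \<open>(P, Q)\<close>, where
  \<open>z = P / Q\<close>, by the inverse of the expanding eigenvalue, which lowers the degree of \<open>Q\<close>.\<close>

lemma attracting_fixed_point_quadratic:
  fixes z :: "'a::{finite,field} fls"
  assumes det: "a * d - b * c = 1" and fix_z: "mob a b c d z = z"
    and \<lambda>: "1 < absv (polyY c * z + polyY d)"
  shows "quadratic z"
proof -
  have nz: "polyY c * z + polyY d \<noteq> 0"
    using \<lambda> by auto
  note eig = fixed_point_eigenvalue[OF det fix_z nz]
  \<comment> \<open>For c = 0 the eigenvalue would be the unit d, of absolute value 1. So c can
    serve as the leading coefficient of an equation for z.\<close>
  have "c \<noteq> 0"
  proof
    assume "c = 0"
    with det have "d dvd 1"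
      by (metis diff_zero dvd_triv_right mult_zero_right)
    then have "d \<noteq> 0"
      by auto
    with \<open>d dvd 1\<close> have "degree d = 0"
      by (simp add: is_unit_iff_degree)
    with \<lambda> \<open>c = 0\<close> \<open>d \<noteq> 0\<close> show False
      by (simp add: absv_polyY_degree_0)
  qed
  moreover have "\<not> inK z"
  proof
    assume "inK z"
    then have "\<exists>Q. Q \<noteq> 0 \<and> (\<exists>P. polyY Q * z = polyY P)"
      unfolding inK_iff by blast
    then obtain Q where Q: "Q \<noteq> 0" "\<exists>P. polyY Q * z = polyY P"
      and min: "\<And>Q'. Q' \<noteq> 0 \<Longrightarrow> \<exists>P. polyY Q' * z = polyY P \<Longrightarrow> degree Q \<le> degree Q'"
      using ex_has_least_nat[of "\<lambda>Q. Q \<noteq> 0 \<and> (\<exists>P. polyY Q * z = polyY P)" _ degree] by metis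
    then obtain P where P: "polyY Q * z = polyY P"
      by blast
    define Q' where "Q' = a * Q - c * P"
    have Q': "polyY Q' = polyY Q * (polyY a - polyY c * z)"
      unfolding Q'_def polyY_simps P[symmetric] by algebra
    have "polyY Q' * z = polyY (d * P - b * Q)"
    proof -
      have "polyY (d * P - b * Q) - polyY Q' * z =
          polyY Q * (polyY c * z\<^sup>2 + polyY (d - a) * z + polyY (- b))"
        unfolding Q' polyY_simps P[symmetric] by algebra
      then show ?thesis
        by (simp add: eig(2))
    qed
    moreover have "Q' \<noteq> 0"
      using Q' Q(1) eig(1) by auto
    ultimately have "degree Q \<le> degree Q'"
      using min by blast
    then have "absv (polyY Q) \<le> absv (polyY Q')"
      using card_field_gt_1[where 'a='a] Q(1) \<open>Q' \<noteq> 0\<close> by (simp add: absv_polyY)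
    moreover have "absv (polyY Q') * absv (polyY c * z + polyY d) = absv (polyY Q)"
      unfolding absv_mult[symmetric] Q' mult.assoc eig(1) by simp
    moreover have "absv (polyY Q') * 1 < absv (polyY Q') * absv (polyY c * z + polyY d)"
      using \<lambda> \<open>Q' \<noteq> 0\<close> by (intro mult_strict_left_mono) auto
    ultimately show False
      by linarith
  qed
  ultimately show ?thesis
    using eig(2) unfolding quadratic_def by blast
qed

section \<open>Periodicity\<close>

text \<open>The inverse homography expands by l^2 near z, so a counterexample at scale R produces
  one at scale R l^2, and after finitely many periods the scale lies in the window of
  \<open>base\<close>. The factor K in the bound on c keeps a counterexample close enough to z for
  the denominator to have the same absolute value as at z.\<close>

lemma periodic_lower_bound:
  fixes \<alpha> z :: "'a::{finite,field} fls" and r r' :: real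
  assumes \<alpha>: "quadratic \<alpha>" and det: "a * d - b * c = 1" and fix_z: "mob a b c d z = z"
    and \<lambda>: "1 < absv (polyY c * z + polyY d)"
    and K: "1 \<le> K" "\<kappa> \<le> K" and c: "absv (polyY c) * (K * r) < absv (polyY c * z + polyY d)"
    and r': "(absv (polyY c * z + polyY d))\<^sup>2 * r' = r" and "0 < r"
    and base: "\<And>R \<beta>. r' < R \<Longrightarrow> R \<le> r \<Longrightarrow> \<beta> \<in> Theta \<alpha> \<Longrightarrow> R \<le> absv (\<beta> - conj \<beta>) \<Longrightarrow>
      \<kappa> * R \<le> absv (z - \<beta>)"
    and R: "0 < R" "R \<le> r" and \<beta>: "\<beta> \<in> Theta \<alpha>" "R \<le> absv (\<beta> - conj \<beta>)"
  shows "\<kappa> * R \<le> absv (z - \<beta>)"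
proof -
  define l where "l = absv (polyY c * z + polyY d)"
  have "1 < l"
    using \<lambda> by (simp add: l_def)
  have nz: "polyY c * z + polyY d \<noteq> 0"
    using \<lambda> by auto
  have r'l: "r' * l\<^sup>2 = r"
    using r' by (simp add: l_def mult.commute)
  note z = quadratic_not_inK[OF attracting_fixed_point_quadratic[OF det fix_z \<lambda>]]
  note eig = fixed_point_eigenvalue(1)[OF det fix_z nz]
  have deti: "d * a - (- b) * (- c) = 1"
    using det by (simp add: mult.commute)
  have az: "absv (polyY (- c) * z + polyY a) = 1 / l"
  proof -
    have "absv (polyY a - polyY c * z) * l = 1"
      unfolding l_def absv_mult[symmetric] eig by simp
    then show ?thesis
      using \<open>1 < l\<close> by (simp add: polyY_minus field_simps)
  qed
  have mobi: "mob d (- b) (- c) a z = z"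
  proof -
    have "mob d (- b) (- c) a (mob a b c d z) = mob 1 0 0 1 z"
      using mob_mob[OF nz, of d "- b" "- c" a] det by (simp add: algebra_simps)
    also have "mob 1 0 0 1 z = z"
      by (simp add: mob_def)
    finally show ?thesis
      by (simp only: fix_z)
  qed
  have main: "\<kappa> * R \<le> absv (z - \<beta>)"
    if "r < R * (l\<^sup>2) ^ Suc n" "0 < R" "R \<le> r" "\<beta> \<in> Theta \<alpha>" "R \<le> absv (\<beta> - conj \<beta>)" for n R \<beta>
    using that
  proof (induction n arbitrary: R \<beta>)
    case 0
    then have "r' < R"
      using \<open>1 < l\<close> by (simp flip: r'l)
    with 0 show ?case
      by (intro base) auto
  next
    case (Suc n)
    show ?case
    proof (cases "r' < R")
      case True
      with Suc.prems show ?thesis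
        by (intro base) auto
    next
      case False
      then have Rr: "R * l\<^sup>2 \<le> r"
        using \<open>1 < l\<close> by (simp flip: r'l)
      show ?thesis
      proof (rule ccontr)
        assume "\<not> \<kappa> * R \<le> absv (z - \<beta>)"
        then have less: "absv (\<beta> - z) < \<kappa> * R"
          by (simp add: absv_minus_commute)
        let ?\<beta>' = "mob d (- b) (- c) a \<beta>"
        note quad = Theta_quadratic[OF \<alpha> Suc.prems(4)]
        note nin = quadratic_not_inK[OF quad] and nin' = quadratic_not_inK[OF quadratic_conj[OF quad]]
        have deti0: "d * a - (- b) * (- c) \<noteq> 0"
          using deti by simp
        have nz1: "polyY (- c) * \<beta> + polyY a \<noteq> 0" "polyY (- c) * conj \<beta> + polyY a \<noteq> 0"
          "polyY (- c) * z + polyY a \<noteq> 0"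
          using denom_nonzero[OF nin deti0] denom_nonzero[OF nin' deti0] denom_nonzero[OF z deti0]
          by auto
        have "\<kappa> * R \<le> K * R"
          using K \<open>0 < R\<close> by (intro mult_right_mono) auto
        with less have "absv (polyY (- c)) * absv (\<beta> - z) * l\<^sup>2 \<le> absv (polyY c) * (K * R) * l\<^sup>2"
          unfolding polyY_minus absv_minus by (intro mult_right_mono mult_left_mono) simp_all
        also have "\<dots> = absv (polyY c) * K * (R * l\<^sup>2)"
          by simp
        also have "\<dots> \<le> absv (polyY c) * K * r"
          using Rr K by (intro mult_left_mono) auto
        also have "\<dots> < l"
          using c by (simp add: l_def mult.assoc)
        finally have "absv (polyY (- c)) * absv (\<beta> - z) < 1 / l"
          using \<open>1 < l\<close> by (simp add: power2_eq_square field_simps)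
        then have a\<beta>: "absv (polyY (- c) * \<beta> + polyY a) = 1 / l"
          using absv_affine_eq[of "- c" \<beta> z a] by (simp add: az)
        have "absv (?\<beta>' - z) = absv (?\<beta>' - mob d (- b) (- c) a z)"
          by (simp only: mobi)
        also have "\<dots> = absv (\<beta> - z) * l\<^sup>2"
          using absv_mob_diff[OF deti nz1(1,3)] by (simp add: a\<beta> az power2_eq_square)
        also have "\<dots> < \<kappa> * (R * l\<^sup>2)"
          using less \<open>1 < l\<close> by (simp add: mult.assoc[symmetric])
        finally have small: "absv (?\<beta>' - z) < \<kappa> * (R * l\<^sup>2)" .
        have conj: "conj ?\<beta>' = mob d (- b) (- c) a (conj \<beta>)"
          by (rule quadratic_mob(2)[OF quad deti0])
        have *: "absv (?\<beta>' - conj ?\<beta>') =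
            absv (\<beta> - conj \<beta>) / (1 / l * absv (polyY (- c) * conj \<beta> + polyY a))"
          unfolding conj absv_mob_diff[OF deti nz1(1,2)] a\<beta> ..
        have c1: "absv (polyY c) * r \<le> l"
        proof -
          have "absv (polyY c) * (1 * r) \<le> absv (polyY c) * (K * r)"
            using K \<open>0 < r\<close> by (intro mult_left_mono mult_right_mono) auto
          with c show ?thesis
            by (simp add: l_def)
        qed
        \<comment> \<open>If the denominator at conj \<beta> is at most 1 / l, the distance of the
          conjugates grows at least by l^2. Otherwise c (\<beta> - conj \<beta>) dominates that
          denominator, the factor |\<beta> - conj \<beta>| cancels, and the new distance is at least
          l / |c|, hence at least r.\<close>
        have "R * l\<^sup>2 * absv (polyY (- c) * conj \<beta> + polyY a) \<le> l * absv (\<beta> - conj \<beta>)"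
        proof (cases "absv (polyY (- c) * conj \<beta> + polyY a) \<le> 1 / l")
          case True
          have "R * l\<^sup>2 * absv (polyY (- c) * conj \<beta> + polyY a) \<le> R * l\<^sup>2 * (1 / l)"
            using True \<open>0 < R\<close> by (intro mult_left_mono) auto
          also have "\<dots> = l * R"
            using \<open>1 < l\<close> by (simp add: power2_eq_square)
          also have "\<dots> \<le> l * absv (\<beta> - conj \<beta>)"
            using Suc.prems(5) \<open>1 < l\<close> by (intro mult_left_mono) auto
          finally show ?thesis .
        next
          case False
          have "absv ((polyY (- c) * \<beta> + polyY a) + polyY c * (\<beta> - conj \<beta>)) \<le>
              max (1 / l) (absv (polyY c) * absv (\<beta> - conj \<beta>))"
            using absv_add_le[of "polyY (- c) * \<beta> + polyY a" "polyY c * (\<beta> - conj \<beta>)"]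
            unfolding a\<beta> absv_mult .
          also have "(polyY (- c) * \<beta> + polyY a) + polyY c * (\<beta> - conj \<beta>) = polyY (- c) * conj \<beta> + polyY a"
            by (simp add: polyY_minus algebra_simps)
          finally have "absv (polyY (- c) * conj \<beta> + polyY a) \<le> absv (polyY c) * absv (\<beta> - conj \<beta>)"
            using False by linarith
          then have "R * l\<^sup>2 * absv (polyY (- c) * conj \<beta> + polyY a) \<le>
              R * l\<^sup>2 * (absv (polyY c) * absv (\<beta> - conj \<beta>))"
            using \<open>0 < R\<close> by (intro mult_left_mono) auto
          also have "\<dots> \<le> r * (absv (polyY c) * absv (\<beta> - conj \<beta>))"
            using Rr by (intro mult_right_mono) auto
          also have "\<dots> = (absv (polyY c) * r) * absv (\<beta> - conj \<beta>)"
            by simp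
          also have "\<dots> \<le> l * absv (\<beta> - conj \<beta>)"
            using c1 by (rule mult_right_mono) simp
          finally show ?thesis .
        qed
        then have large: "R * l\<^sup>2 \<le> absv (?\<beta>' - conj ?\<beta>')"
          unfolding * using nz1(2) \<open>1 < l\<close> by (simp add: pos_le_divide_eq mult.commute)
        have "\<kappa> * (R * l\<^sup>2) \<le> absv (z - ?\<beta>')"
        proof (rule Suc.IH)
          show "r < R * l\<^sup>2 * (l\<^sup>2) ^ Suc n"
            using Suc.prems(1) by (simp add: mult.assoc)
          show "?\<beta>' \<in> Theta \<alpha>"
            by (rule mob_in_Theta[OF \<alpha> Suc.prems(4) deti])
        qed (use \<open>0 < R\<close> \<open>1 < l\<close> Rr large in auto)
        with small show False
          by (simp add: absv_minus_commute)
      qed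
    qed
  qed
  obtain n where "r / R < (l\<^sup>2) ^ n"
    using real_arch_pow[of "l\<^sup>2" "r / R"] \<open>1 < l\<close> by (auto simp: one_less_power)
  then have "r < R * (l\<^sup>2) ^ n"
    using R by (simp add: field_simps)
  also have "\<dots> \<le> R * (l\<^sup>2) ^ Suc n"
    using R \<open>1 < l\<close> by (intro mult_left_mono power_increasing) (auto simp: one_le_power)
  finally show ?thesis
    using R \<beta> by (rule main)
qed

text \<open>Both \<beta> and its conjugate lie in the ball of radius K r about z, where all
  denominators have absolute value l. Each application of the homography thus divides both distances
  by l^2 and preserves their ratio.\<close>

lemma periodic_approximations:
  fixes \<alpha> z :: "'a::{finite,field} fls"
  assumes \<alpha>: "quadratic \<alpha>" and det: "a * d - b * c = 1" and fix_z: "mob a b c d z = z"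
    and \<lambda>: "1 < absv (polyY c * z + polyY d)"
    and K: "1 \<le> K" "\<kappa> \<le> K" and c: "absv (polyY c) * (K * r) < absv (polyY c * z + polyY d)"
    and \<beta>: "\<beta> \<in> Theta \<alpha>" "absv (\<beta> - conj \<beta>) = r" "absv (z - \<beta>) = \<kappa> * r"
    and "0 < \<delta>"
  obtains \<gamma> where "\<gamma> \<in> Theta \<alpha>" "absv (\<gamma> - conj \<gamma>) < \<delta>" "absv (z - \<gamma>) = \<kappa> * absv (\<gamma> - conj \<gamma>)"
proof -
  define l where "l = absv (polyY c * z + polyY d)"
  have "1 < l"
    using \<lambda> by (simp add: l_def)
  have "0 \<le> r"
    using \<beta>(2) by auto
  have nz: "polyY c * z + polyY d \<noteq> 0"
    using \<lambda> by auto
  have det0: "a * d - b * c \<noteq> 0"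
    using det by simp
  have "\<exists>\<gamma>\<in>Theta \<alpha>. absv (\<gamma> - conj \<gamma>) = r / (l\<^sup>2) ^ n \<and> absv (z - \<gamma>) = \<kappa> * (r / (l\<^sup>2) ^ n)" for n
  proof (induction n)
    case 0
    then show ?case
      using \<beta> by auto
  next
    case (Suc n)
    define R where "R = r / (l\<^sup>2) ^ n"
    obtain \<gamma> where \<gamma>: "\<gamma> \<in> Theta \<alpha>" "absv (\<gamma> - conj \<gamma>) = R" "absv (\<gamma> - z) = \<kappa> * R"
      using Suc by (auto simp: R_def absv_minus_commute)
    note quad = Theta_quadratic[OF \<alpha> \<gamma>(1)]
    note nin = quadratic_not_inK[OF quad] and nin' = quadratic_not_inK[OF quadratic_conj[OF quad]]
    note nz1 = denom_nonzero[OF nin det0] denom_nonzero[OF nin' det0]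
    have "0 \<le> R" "R \<le> r"
      using \<open>0 \<le> r\<close> \<open>1 < l\<close> by (auto simp: R_def divide_le_eq one_le_power mult_le_cancel_left1)
    have "\<kappa> * R \<le> K * R" "1 * R \<le> K * R" "K * R \<le> K * r"
      using K \<open>0 \<le> R\<close> \<open>R \<le> r\<close> by (intro mult_right_mono mult_left_mono; simp)+
    then have near: "absv (\<gamma> - z) \<le> K * r" "absv (conj \<gamma> - \<gamma>) \<le> K * r"
      using \<gamma> by (simp_all add: absv_minus_commute)
    then have near': "absv (conj \<gamma> - z) \<le> K * r"
      using absv_diff_trans_le by blast
    have den: "absv (polyY c * x + polyY d) = l" if "absv (x - z) \<le> K * r" for x
    proof -
      have "absv (polyY c) * absv (x - z) \<le> absv (polyY c) * (K * r)"
        using that by (rule mult_left_mono) simp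
      with c show ?thesis
        unfolding l_def by (intro absv_affine_eq) simp
    qed
    let ?\<gamma> = "mob a b c d \<gamma>"
    have conj: "conj ?\<gamma> = mob a b c d (conj \<gamma>)"
      by (rule quadratic_mob(2)[OF quad det0])
    have "absv (?\<gamma> - conj ?\<gamma>) = R / l\<^sup>2"
      unfolding conj absv_mob_diff[OF det nz1] den[OF near(1)] den[OF near'] \<gamma>(2)
      by (simp add: power2_eq_square)
    moreover have "absv (?\<gamma> - mob a b c d z) = \<kappa> * R / l\<^sup>2"
      unfolding absv_mob_diff[OF det nz1(1) nz] den[OF near(1)] \<gamma>(3) l_def[symmetric]
      by (simp add: power2_eq_square)
    then have "absv (z - ?\<gamma>) = \<kappa> * (R / l\<^sup>2)"
      unfolding fix_z by (simp add: absv_minus_commute)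
    moreover have "R / l\<^sup>2 = r / (l\<^sup>2) ^ Suc n"
      by (simp add: R_def mult.commute)
    ultimately show ?case
      using mob_in_Theta[OF \<alpha> \<gamma>(1) det] by auto
  qed
  moreover obtain n where n: "r / \<delta> < (l\<^sup>2) ^ n"
    using real_arch_pow[of "l\<^sup>2" "r / \<delta>"] \<open>1 < l\<close> by (auto simp: one_less_power)
  then have "r / (l\<^sup>2) ^ n < \<delta>"
    using \<open>0 < \<delta>\<close> \<open>1 < l\<close> by (simp add: field_simps)
  ultimately show thesis
    using that by metis
qed

theorem theorem1p3:
  fixes \<alpha> :: "'a::{finite,field} fls" and m :: int
  assumes "quadratic \<alpha>"
    and "ereal (real CARD('a) powr (- real_of_int m)) \<in> Sp \<alpha>"
  shows "\<exists>f. quadratic f \<and> f \<notin> Theta \<alpha> \<and>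
           c_alpha \<alpha> f = ereal (real CARD('a) powr (- real_of_int m))"
proof -
  let ?q = "real CARD('a)"
  note q = card_field_gt_1[where 'a='a] and \<alpha> = assms(1)
  define \<kappa> where "\<kappa> = ?q powi (- m)"
  define r where "r s = ?q powi (- s)" for s
  have \<kappa>: "?q powr (- real_of_int m) = \<kappa>"
    using powr_real_of_int'[of ?q "- m"] q by (simp add: \<kappa>_def)
  have "0 < \<kappa>" and r_pos: "\<And>s. 0 < r s"
    using q by (simp_all add: \<kappa>_def r_def)
  obtain f where f: "\<not> inK f" "f \<notin> Theta \<alpha>" and c_f: "c_alpha \<alpha> f = ereal \<kappa>"
    using assms(2) unfolding \<kappa> Sp_def by auto
  have low: "\<exists>\<delta>>0. \<forall>\<beta>\<in>Theta \<alpha>. absv (\<beta> - conj \<beta>) < \<delta> \<longrightarrow> \<kappa> * absv (\<beta> - conj \<beta>) \<le> absv (f - \<beta>)"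
    and freq: "\<And>\<delta>. 0 < \<delta> \<Longrightarrow> \<exists>\<beta>\<in>Theta \<alpha>. absv (\<beta> - conj \<beta>) < \<delta> \<and> absv (f - \<beta>) = \<kappa> * absv (\<beta> - conj \<beta>)"
    using c_alpha_eq_iff[OF \<alpha>, of f "- m"] c_f unfolding \<kappa>_def by blast+
  obtain R0 where "0 < R0" and R0: "\<And>R \<beta>. R \<le> R0 \<Longrightarrow> \<beta> \<in> Theta \<alpha> \<Longrightarrow> R \<le> absv (\<beta> - conj \<beta>) \<Longrightarrow>
      \<kappa> * R \<le> absv (f - \<beta>)"
    using low Theta_uniform_lower_bound[OF \<alpha> f(2) \<open>0 < \<kappa>\<close>] by metis
  obtain D where "0 < D" and form: "\<And>\<beta>. \<beta> \<in> Theta \<alpha> \<Longrightarrow> \<exists>A B C. A \<noteq> 0 \<and>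
      polyY A * (\<beta> + conj \<beta>) = polyY B \<and> polyY A * (\<beta> * conj \<beta>) = polyY C \<and>
      absv (polyY A) * absv (\<beta> - conj \<beta>) = D"
    using Theta_form[OF \<alpha>] by metis
  \<comment> \<open>K times a scale r covers both |\<beta> - conj \<beta>| = r and |f - \<beta>| =
    \<kappa> r, whether \<kappa> is below or above 1.\<close>
  define K where "K = max 1 \<kappa>"
  have K: "1 \<le> K" "\<kappa> \<le> K"
    by (auto simp: K_def)
  \<comment> \<open>\<open>\<epsilon> < \<kappa>\<close> makes f and z indistinguishable for the
    estimates at all scales from \<open>r l\<close> upwards; \<open>\<epsilon> * K < 1\<close> makes
    the denominator constant on the ball of radius K \<open>r k\<close>;
    \<open>\<epsilon> < 1\<close> gives the hypothesis for the fixed point.\<close>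
  define \<epsilon> where "\<epsilon> = min \<kappa> (1 / K) / 2"
  have "0 < \<epsilon>" "\<epsilon> < \<kappa>" "\<epsilon> * K < 1" "\<epsilon> < 1"
  proof -
    have "\<epsilon> \<le> \<kappa> / 2" "\<epsilon> \<le> (1 / K) / 2"
      unfolding \<epsilon>_def by (intro divide_right_mono; simp)+
    moreover have "(1 / K) / 2 * K < 1" "(1 / K) / 2 < 1"
      using K by (simp_all add: field_simps)
    moreover have "\<epsilon> * K \<le> (1 / K) / 2 * K"
      using K \<open>\<epsilon> \<le> (1 / K) / 2\<close> by (intro mult_right_mono) auto
    ultimately show "\<epsilon> < \<kappa>" "\<epsilon> * K < 1" "\<epsilon> < 1"
      using \<open>0 < \<kappa>\<close> by linarith+
    show "0 < \<epsilon>"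
      using \<open>0 < \<kappa>\<close> K by (simp add: \<epsilon>_def)
  qed
  \<comment> \<open>Exponents of the scales at which the lower limit is attained, cut off at
    \<open>R0\<close> so that the bound with free R holds there. Were there finitely many,
    \<open>freq\<close> would supply a scale below all of them.\<close>
  define S where "S = {s. r s \<le> R0 \<and> (\<exists>\<beta>\<in>Theta \<alpha>. absv (\<beta> - conj \<beta>) = r s \<and> absv (f - \<beta>) = \<kappa> * r s)}"
  have "infinite S"
  proof
    assume "finite S"
    define \<delta> where "\<delta> = Min (insert R0 (r ` S))"
    have "0 < \<delta>"
      using \<open>finite S\<close> \<open>0 < R0\<close> r_pos by (auto simp: \<delta>_def)
    then obtain \<beta> where \<beta>: "\<beta> \<in> Theta \<alpha>" "absv (\<beta> - conj \<beta>) < \<delta>"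
        "absv (f - \<beta>) = \<kappa> * absv (\<beta> - conj \<beta>)"
      using freq by blast
    define s where "s = fls_subdegree (\<beta> - conj \<beta>)"
    have "\<beta> - conj \<beta> \<noteq> 0"
      using conj_neq[OF Theta_quadratic[OF \<alpha> \<beta>(1)]] by auto
    then have s: "absv (\<beta> - conj \<beta>) = r s"
      unfolding r_def s_def by (rule absv_nonzero)
    have "\<delta> \<le> R0"
      unfolding \<delta>_def using \<open>finite S\<close> by (intro Min_le) auto
    with \<beta> s have "s \<in> S"
      unfolding S_def by fastforce
    then have "\<delta> \<le> r s"
      unfolding \<delta>_def using \<open>finite S\<close> by (intro Min_le) auto
    with \<beta>(2) s show False
      by simp
  qed
  have red: "\<exists>a b c d. a * d - b * c = 1 \<and>
      (absv (polyY a * f + polyY b))\<^sup>2 \<le> D * K\<^sup>2 * r s \<and> (absv (polyY c * f + polyY d))\<^sup>2 \<le> D * K\<^sup>2 * r s \<and>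
      (absv (polyY a))\<^sup>2 * r s \<le> D * K\<^sup>2 \<and> (absv (polyY c))\<^sup>2 * r s \<le> D * K\<^sup>2" if s: "s \<in> S" for s
  proof -
    obtain \<beta> where \<beta>: "\<beta> \<in> Theta \<alpha>" "absv (\<beta> - conj \<beta>) = r s" "absv (f - \<beta>) = \<kappa> * r s"
      using s unfolding S_def by blast
    note quad = Theta_quadratic[OF \<alpha> \<beta>(1)]
    note nin = quadratic_not_inK[OF quad] quadratic_not_inK[OF quadratic_conj[OF quad]]
    obtain A B C where ABC: "A \<noteq> 0" "polyY A * (\<beta> + conj \<beta>) = polyY B"
      "polyY A * (\<beta> * conj \<beta>) = polyY C" "absv (polyY A) * absv (\<beta> - conj \<beta>) = D"
      using form[OF \<beta>(1)] by blast
    have "1 * r s \<le> K * r s" "\<kappa> * r s \<le> K * r s"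
      using K r_pos[of s] by (intro mult_right_mono; simp)+
    then have \<rho>: "absv (\<beta> - conj \<beta>) \<le> K * r s" "absv (f - \<beta>) \<le> K * r s"
      using \<beta> by simp_all
    obtain a b c d where det: "a * d - b * c = 1"
      and 1: "(absv (polyY a * f + polyY b))\<^sup>2 * r s \<le> D * (K * r s)\<^sup>2"
        "(absv (polyY c * f + polyY d))\<^sup>2 * r s \<le> D * (K * r s)\<^sup>2"
      and 2: "(absv (polyY a))\<^sup>2 * r s \<le> D" "(absv (polyY c))\<^sup>2 * r s \<le> D"
      using Theta_reduction[OF f(1) nin conj_neq[OF quad] ABC \<rho>] unfolding \<beta>(2) .
    have *: "D * (K * r s)\<^sup>2 = D * K\<^sup>2 * r s * r s"
      by (simp add: power2_eq_square)
    have "D * 1 \<le> D * K\<^sup>2"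
      using \<open>0 < D\<close> K by (intro mult_left_mono) (auto simp: one_le_power)
    then have "D \<le> D * K\<^sup>2"
      by simp
    note 3 = 1[unfolded * mult_le_cancel_right_pos[OF r_pos]] 2[THEN order_trans, OF this]
    show ?thesis
      by (intro exI conjI) (rule det 3)+
  qed
  obtain k l a b c d where S: "k \<in> S" "l \<in> S" and "k < l" and det: "a * d - b * c = 1"
    and ratio: "(absv (polyY c * f + polyY d))\<^sup>2 * r l = r k"
    and c: "absv (polyY c) * r k \<le> \<epsilon> * absv (polyY c * f + polyY d)"
    and near: "absv (mob a b c d f - f) \<le> \<epsilon> * r l"
    using approximate_period[OF \<open>infinite S\<close> \<open>0 < \<epsilon>\<close>, of f "D * K\<^sup>2"] red unfolding r_def by metis
  have "r l < r k"
    using \<open>k < l\<close> powi_less_iff[OF q] by (simp add: r_def)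
  define v where "v = absv (polyY c * f + polyY d)"
  have "1 < v"
  proof (rule ccontr)
    assume "\<not> 1 < v"
    then have "v\<^sup>2 * r l \<le> 1 * r l"
      using r_pos[of l] by (intro mult_right_mono) (auto simp: v_def power_le_one)
    with ratio \<open>r l < r k\<close> show False
      by (simp add: v_def)
  qed
  have "absv (polyY c) * (\<epsilon> * r l) \<le> absv (polyY c) * (1 * r k)"
    using \<open>\<epsilon> < 1\<close> \<open>0 < \<epsilon>\<close> \<open>r l < r k\<close> r_pos[of l] by (intro mult_left_mono mult_mono) auto
  also have "\<dots> \<le> \<epsilon> * v"
    using c by (simp add: v_def)
  also have "\<dots> < v"
    using \<open>\<epsilon> < 1\<close> \<open>1 < v\<close> by simp
  finally have c_less: "absv (polyY c) * (\<epsilon> * r l) < v" .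
  have "0 < \<epsilon> * r l"
    using \<open>0 < \<epsilon>\<close> r_pos[of l] by simp
  then obtain z where z: "mob a b c d z = z" and fz: "absv (f - z) \<le> \<epsilon> * r l"
    and v: "absv (polyY c * z + polyY d) = v"
    using attracting_fixed_point[OF det, of f "\<epsilon> * r l"] \<open>1 < v\<close> near c_less unfolding v_def by metis
  have quad: "quadratic z"
    using attracting_fixed_point_quadratic[OF det z] \<open>1 < v\<close> v by simp
  have fz_less: "absv (f - z) < \<kappa> * R" if "r l \<le> R" for R
  proof -
    have "\<epsilon> * r l < \<kappa> * r l"
      using \<open>\<epsilon> < \<kappa>\<close> r_pos[of l] by simp
    also have "\<dots> \<le> \<kappa> * R"
      using that \<open>0 < \<kappa>\<close> by simp
    finally show ?thesis
      using fz by simp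
  qed
  have cK: "absv (polyY c) * (K * r k) < v"
  proof -
    have "absv (polyY c) * (K * r k) = K * (absv (polyY c) * r k)"
      by simp
    also have "\<dots> \<le> K * (\<epsilon> * v)"
      using c K by (intro mult_left_mono) (auto simp: v_def)
    also have "\<dots> = (\<epsilon> * K) * v"
      by simp
    also have "\<dots> < 1 * v"
      using \<open>\<epsilon> * K < 1\<close> \<open>1 < v\<close> by (intro mult_strict_right_mono) auto
    finally show ?thesis
      by simp
  qed
  have v1: "1 < absv (polyY c * z + polyY d)"
    and cKv: "absv (polyY c) * (K * r k) < absv (polyY c * z + polyY d)"
    and ratio': "(absv (polyY c * z + polyY d))\<^sup>2 * r l = r k"
    using \<open>1 < v\<close> cK ratio by (simp_all only: v v_def)
  \<comment> \<open>Over a whole period of scales, |f - z| is smaller than \<kappa> R, so a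
    violation at z would be a violation at f.\<close>
  have base: "\<kappa> * R \<le> absv (z - \<beta>)"
    if R: "r l < R" "R \<le> r k" and \<beta>: "\<beta> \<in> Theta \<alpha>" "R \<le> absv (\<beta> - conj \<beta>)" for R \<beta>
  proof (rule ccontr)
    assume "\<not> \<kappa> * R \<le> absv (z - \<beta>)"
    then have "absv (z - \<beta>) < \<kappa> * R"
      by simp
    with fz_less[OF less_imp_le[OF R(1)]] have "absv (f - \<beta>) < \<kappa> * R"
      by (rule absv_diff_trans_less)
    moreover have "R \<le> R0"
      using R(2) S(1) by (simp add: S_def)
    then have "\<kappa> * R \<le> absv (f - \<beta>)"
      using \<beta> by (rule R0)
    ultimately show False
      by simp
  qed
  note lower = periodic_lower_bound[OF \<alpha> det z v1 K cKv ratio' r_pos base]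
  \<comment> \<open>An orbit point would violate its own lower bound, as |z - z| = 0 while R may be
    taken positive.\<close>
  have "z \<notin> Theta \<alpha>"
  proof
    assume "z \<in> Theta \<alpha>"
    moreover define R where "R = min (r k) (absv (z - conj z))"
    moreover have "0 < R"
      using conj_neq[OF quad] r_pos by (auto simp: R_def)
    ultimately have "\<kappa> * R \<le> absv (z - z)"
      by (intro lower) auto
    with \<open>0 < R\<close> \<open>0 < \<kappa>\<close> show False
      by (simp add: mult_le_0_iff)
  qed
  moreover have "c_alpha \<alpha> z = ereal \<kappa>"
    unfolding \<kappa>_def c_alpha_eq_iff[OF \<alpha>]
  proof (intro conjI allI impI, fold \<kappa>_def)
    show "\<exists>\<delta>>0. \<forall>\<beta>\<in>Theta \<alpha>. absv (\<beta> - conj \<beta>) < \<delta> \<longrightarrow> \<kappa> * absv (\<beta> - conj \<beta>) \<le> absv (z - \<beta>)"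
    proof (intro exI conjI ballI impI)
      fix \<beta>
      assume \<beta>: "\<beta> \<in> Theta \<alpha>" "absv (\<beta> - conj \<beta>) < r k"
      have "0 < absv (\<beta> - conj \<beta>)"
        using conj_neq[OF Theta_quadratic[OF \<alpha> \<beta>(1)]] by auto
      with \<beta> show "\<kappa> * absv (\<beta> - conj \<beta>) \<le> absv (z - \<beta>)"
        by (intro lower) auto
    qed (rule r_pos)
  next
    fix \<delta> :: real
    assume "0 < \<delta>"
    obtain \<beta> where \<beta>: "\<beta> \<in> Theta \<alpha>" "absv (\<beta> - conj \<beta>) = r k" "absv (f - \<beta>) = \<kappa> * r k"
      using S(1) unfolding S_def by blast
    \<comment> \<open>Since |f - z| < \<kappa> \<open>r k\<close> = |f - \<beta>|, the equality at
      scale \<open>r k\<close> passes unchanged from f to z and seeds the periodic sequence of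
      equalities.\<close>
    have "absv ((f - \<beta>) + (- (f - z))) = absv (f - \<beta>)"
      using fz_less[of "r k"] \<open>r l < r k\<close> by (intro absv_add_eq) (simp only: absv_minus \<beta>(3) less_imp_le)
    then have z\<beta>: "absv (z - \<beta>) = \<kappa> * r k"
      using \<beta>(3) by (simp add: algebra_simps)
    obtain \<gamma> where "\<gamma> \<in> Theta \<alpha>" "absv (\<gamma> - conj \<gamma>) < \<delta>" "absv (z - \<gamma>) = \<kappa> * absv (\<gamma> - conj \<gamma>)"
      using periodic_approximations[OF \<alpha> det z v1 K cKv \<beta>(1,2) z\<beta> \<open>0 < \<delta>\<close>] .
    then show "\<exists>\<beta>\<in>Theta \<alpha>. absv (\<beta> - conj \<beta>) < \<delta> \<and> absv (z - \<beta>) = \<kappa> * absv (\<beta> - conj \<beta>)"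
      by blast
  qed
  ultimately show ?thesis
    unfolding \<kappa> using quad by blast
qed

end
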